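(* Let $p\in[1,\infty)$, let $\Lambda:\mathbb R\to[0,1]$ be a right-continuous decreasing function such that $\mathrm{EVaR}^p_\Lambda$ is finite on $L^p$, and define $T_\Lambda:\overline{\mathbb R}\times\mathbb R\times L^p\to\overline{\mathbb R}$ by $$T_\Lambda(t,x,X)=\max\left\{t+\left(\frac1{1-\Lambda(x)}\right)^{1/p}\|(X-t)_+\|_p,\ x\right\}.$$ Then $$\mathrm{EVaR}^p_\Lambda(X)=\min_{(t,x)\in\overline{\mathbb R}\times\mathbb R}T_\Lambda(t,x,X),\qquad X\in L^p,$$ where the minimum is attained at $x^*=\mathrm{EVaR}^p_\Lambda(X)$ and $t^*\in[\mathrm{VaR}^p_{\Lambda(x^* )}(X),\mathrm{VaR}^{p+}_{\Lambda(x^* )}(X)]$ if $\Lambda(x^* )\in[0,1)$, $t^*=\mathrm{VaR}^{p+}_1(X)$ if $\Lambda(x^* )=1$. Moreover: (i) $T_\Lambda(t,x,X)$ is jointly convex in $(t,X)\in\overline{\mathbb R}\times L^p$ for all $x\in\mathbb R$; (ii) $T_\Lambda(t,x,X)$ is convex in $x\in\mathbb R$ for all $(t,X)\in\overline{\mathbb R}\times L^p$ if and only if the function $x\mapsto(1/(1-\Lambda(x)))^{1/p}$ is convex; (iii) the following statements are equivalent: (a) $T_\Lambda(t,x,X)$ is jointly convex in $(t,x)\in\overline{\mathbb R}\times\mathbb R$ for all $X\in L^p$; (b) $T_\Lambda(t,x,X)$ is jointly quasi-convex in $(t,x)\in\overline{\mathbb R}\times\mathbb R$ for all $X\in L^p$;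 (c) $T_\Lambda(t,x,X)$ is jointly convex in $(t,x,X)\in\overline{\mathbb R}\times\mathbb R\times L^p$; (d) $T_\Lambda(t,x,X)$ is jointly quasi-convex in $(t,x,X)\in\overline{\mathbb R}\times\mathbb R\times L^p$; (e) $\Lambda$ is constant on $\mathbb R$.
   Context: $(\Omega,\mathcal F,\mathbb P)$ is an atomless probability space, $L^p=L^p(\Omega,\mathcal F,\mathbb P)$, $\overline{\mathbb R}=[-\infty,\infty]$, $u_+=\max\{u,0\}$. "Increasing" and "decreasing" are meant in the weak (non-strict) sense. Let $p\in[1,\infty)$ and $q\in(1,\infty]$ with $1/p+1/q=1$. Rényi entropy: for a probability measure $\mathbb Q\ll\mathbb P$, $H_q(d\mathbb Q/d\mathbb P)=\frac1{q-1}\log\mathbb E[(d\mathbb Q/d\mathbb P)^q]$ if $q\in(1,\infty)$, and $H_\infty(d\mathbb Q/d\mathbb P)=\log\|d\mathbb Q/d\mathbb P\|_\infty$; $H_q=\infty$ if these are not finite or if $\mathbb Q\not\ll\mathbb P$. Rényi entropic value-at-risk: for $X\in L^p$ and $\alpha\in[0,1)$, $\mathrm{EVaR}^p_\alpha(X)=\sup\{\mathbb E_{\mathbb Q}[X]: H_q(d\mathbb Q/d\mathbb P)\le\log\frac1{1-\alpha}\}$; and $\mathrm{EVaR}^p_1(X)=\operatorname{ess\,sup}(X)$. Lambda version, for decreasing $\Lambda:\mathbb R\to[0,1]$: $\mathrm{EVaR}^p_\Lambda:L^p\to\overline{\mathbb R}$, $\mathrm{EVaR}^p_\Lambda(X)=\sup_{x\in\mathbb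 R}\min\{\mathrm{EVaR}^p_{\Lambda(x)}(X),x\}$. "Finite on $L^p$" means $\mathrm{EVaR}^p_\Lambda(X)\in\mathbb R$ for every $X\in L^p$. For $\alpha\in[0,1]$ and $X\in L^p$, $\mathrm{VaR}^p_\alpha(X)$ and $\mathrm{VaR}^{p+}_\alpha(X)$ denote respectively the infimum and the supremum of the set $\arg\min_{t\in\overline{\mathbb R}}\{t+(\frac1{1-\alpha})^{1/p}(\mathbb E[(X-t)_+^p])^{1/p}\}$ (for $\alpha=1$ both are $\operatorname{ess\,sup}(X)$). Conventions: $0/0=0$ and $x/0=\infty$ for $x>0$ (so for $\Lambda(x)=1$ the term $(\frac1{1-\Lambda(x)})^{1/p}\|(X-t)_+\|_p$ equals $0$ if $\|(X-t)_+\|_p=0$ and $\infty$ otherwise; and $(1/(1-\Lambda(x)))^{1/p}=\infty$). Values of $t+(\frac1{1-\alpha})^{1/p}\|(X-t)_+\|_p$ at $t=\pm\infty$ are understood as limits as $t\to\pm\infty$. (Quasi-)convexity is understood for extended-real-valued functions, i.e. the defining inequality holds for all weights $\lambda\in(0,1)$ and all pairs of points for which the convex combination is well defined (excluding combinations of $t=-\infty$ with $t=+\infty$). *)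

theory Defs
  imports "HOL-Probability.Probability"
begin

definition atomless :: "'a measure \<Rightarrow> bool" where
  "atomless M \<longleftrightarrow>
     (\<forall>A\<in>sets M. emeasure M A > 0 \<longrightarrow>
        (\<exists>B\<in>sets M. B \<subseteq> A \<and> 0 < emeasure M B \<and> emeasure M B < emeasure M A))"

text \<open>Elements of \<open>L\<^sup>p\<close> are represented by functions rather than by almost-everywhere classes;
  every functional below is invariant under almost-everywhere equality.\<close>

definition Lp :: "'a measure \<Rightarrow> real \<Rightarrow> ('a \<Rightarrow> real) set" where
  "Lp M p = {X \<in> borel_measurable M. integrable M (\<lambda>\<omega>. \<bar>X \<omega>\<bar> powr p)}"

definition Lp_norm :: "'a measure \<Rightarrow> real \<Rightarrow> ('a \<Rightarrow> real) \<Rightarrow> real" where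
  "Lp_norm M p X = (\<integral>\<omega>. \<bar>X \<omega>\<bar> powr p \<partial>M) powr (1 / p)"

definition ess_sup :: "'a measure \<Rightarrow> ('a \<Rightarrow> real) \<Rightarrow> ereal" where
  "ess_sup M X = esssup M (\<lambda>\<omega>. ereal (X \<omega>))"

definition conjugate_exponent :: "real \<Rightarrow> ereal" where
  "conjugate_exponent p = (if p = 1 then \<infinity> else ereal (p / (p - 1)))"

lemma conjugate_exponent_iff:
  fixes q :: ereal
  assumes "p \<ge> 1"
  shows "q = conjugate_exponent p \<longleftrightarrow> 1 < q \<and> 1 / ereal p + 1 / q = 1"
proof (cases q)
  case (real r)
  have "r = p / (p - 1) \<longleftrightarrow> 1 < r \<and> 1 / p + 1 / r = 1" if "p > 1"
  proof
    assume r: "r = p / (p - 1)"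
    have "1 < p / (p - 1)" using that by (subst less_divide_eq_1_pos) auto
    moreover have "1 / p + (p - 1) / p = 1" using that by (simp add: diff_divide_distrib)
    ultimately show "1 < r \<and> 1 / p + 1 / r = 1" using r by simp
  next
    assume r: "1 < r \<and> 1 / p + 1 / r = 1"
    then have "p * r * (1 / p + 1 / r) = p * r" by simp
    with r that have "r + p = p * r" by (auto simp: field_simps)
    with that show "r = p / (p - 1)" by (simp add: eq_divide_eq algebra_simps)
  qed
  with real assms show ?thesis
    by (cases "p = 1") (auto simp: conjugate_exponent_def one_ereal_def)
qed (use assms in \<open>auto simp: conjugate_exponent_def one_ereal_def\<close>)

text \<open>The Renyi entropy of order \<open>q \<in> (1, \<infinity>]\<close> of a probability measure \<open>Q\<close> on the measurable
  space of \<open>M\<close>, as a function of \<open>Q\<close> itself so that it also covers measures that are not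
  absolutely continuous.  The density is almost everywhere finite, so that passing to its real
  value loses nothing.\<close>

definition renyi_entropy :: "'a measure \<Rightarrow> ereal \<Rightarrow> 'a measure \<Rightarrow> ereal" where
  "renyi_entropy M q Q =
     (if \<not> absolutely_continuous M Q then \<infinity>
      else if q = \<infinity> then
        (if esssup M (RN_deriv M Q) < \<infinity>
         then ereal (ln (enn2real (esssup M (RN_deriv M Q)))) else \<infinity>)
      else
        (let r = real_of_ereal q; Z = (\<lambda>\<omega>. enn2real (RN_deriv M Q \<omega>)) in
         if integrable M (\<lambda>\<omega>. Z \<omega> powr r)
         then ereal (1 / (r - 1) * ln (\<integral>\<omega>. Z \<omega> powr r \<partial>M)) else \<infinity>))"

definition EVaR :: "'a measure \<Rightarrow> real \<Rightarrow> real \<Rightarrow> ('a \<Rightarrow> real) \<Rightarrow> ereal" where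
  "EVaR M p \<alpha> X =
     (if \<alpha> = 1 then ess_sup M X
      else Sup {ereal (\<integral>\<omega>. X \<omega> \<partial>Q) | Q.
             prob_space Q \<and> sets Q = sets M \<and>
             renyi_entropy M (conjugate_exponent p) Q \<le> ereal (ln (1 / (1 - \<alpha>)))})"

definition EVaR_Lambda :: "'a measure \<Rightarrow> real \<Rightarrow> (real \<Rightarrow> real) \<Rightarrow> ('a \<Rightarrow> real) \<Rightarrow> ereal" where
  "EVaR_Lambda M p \<Lambda> X = (SUP x::real. min (EVaR M p (\<Lambda> x) X) (ereal x))"

text \<open>\<open>(1 / (1 - \<alpha>))\<^bsup>1/p\<^esup>\<close> for \<open>\<alpha> \<in> [0, 1]\<close> with the convention \<open>1/0 = \<infinity>\<close>.  The convention
  \<open>0/0 = 0\<close> is covered by \<open>\<infinity> * 0 = 0\<close> in \<open>ereal\<close>.\<close>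

definition level_coeff :: "real \<Rightarrow> real \<Rightarrow> ereal" where
  "level_coeff p \<alpha> = (if \<alpha> = 1 then \<infinity> else ereal ((1 / (1 - \<alpha>)) powr (1 / p)))"

definition evar_objective_real ::
    "'a measure \<Rightarrow> real \<Rightarrow> real \<Rightarrow> ('a \<Rightarrow> real) \<Rightarrow> real \<Rightarrow> ereal" where
  "evar_objective_real M p \<alpha> X t =
     ereal t + level_coeff p \<alpha> * ereal (Lp_norm M p (\<lambda>\<omega>. max (X \<omega> - t) 0))"

definition evar_objective ::
    "'a measure \<Rightarrow> real \<Rightarrow> real \<Rightarrow> ('a \<Rightarrow> real) \<Rightarrow> ereal \<Rightarrow> ereal" where
  "evar_objective M p \<alpha> X t =
     (case t of
        ereal r \<Rightarrow> evar_objective_real M p \<alpha> X r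
      | PInfty \<Rightarrow> Lim at_top (evar_objective_real M p \<alpha> X)
      | MInfty \<Rightarrow> Lim at_bot (evar_objective_real M p \<alpha> X))"

definition VaR :: "'a measure \<Rightarrow> real \<Rightarrow> real \<Rightarrow> ('a \<Rightarrow> real) \<Rightarrow> ereal" where
  "VaR M p \<alpha> X =
     (if \<alpha> = 1 then ess_sup M X
      else Inf {t. is_arg_min (evar_objective M p \<alpha> X) (\<lambda>_. True) t})"

definition VaR_plus :: "'a measure \<Rightarrow> real \<Rightarrow> real \<Rightarrow> ('a \<Rightarrow> real) \<Rightarrow> ereal" where
  "VaR_plus M p \<alpha> X =
     (if \<alpha> = 1 then ess_sup M X
      else Sup {t. is_arg_min (evar_objective M p \<alpha> X) (\<lambda>_. True) t})"

definition T_Lambda ::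
    "'a measure \<Rightarrow> real \<Rightarrow> (real \<Rightarrow> real) \<Rightarrow> ereal \<Rightarrow> real \<Rightarrow> ('a \<Rightarrow> real) \<Rightarrow> ereal" where
  "T_Lambda M p \<Lambda> t x X = max (evar_objective M p (\<Lambda> x) X t) (ereal x)"

text \<open>Since \<open>ereal\<close> is not a vector space, convex combinations are introduced as a syntactic class
  closed under products and function spaces.  \<open>comb_ok a b\<close> says that the combinations of \<open>a\<close> and
  \<open>b\<close> are well defined: \<open>-\<infinity>\<close> and \<open>\<infinity>\<close> may not be combined, whereas the sum of \<open>ereal\<close> would
  return \<open>\<infinity>\<close>.\<close>

class convex_comb =
  fixes comb :: "real \<Rightarrow> 'a \<Rightarrow> 'a \<Rightarrow> 'a"
    and comb_ok :: "'a \<Rightarrow> 'a \<Rightarrow> bool"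

instantiation real :: convex_comb
begin
definition "comb l (x::real) y = l * x + (1 - l) * y"
definition "comb_ok (x::real) (y::real) = True"
instance ..
end

instantiation ereal :: convex_comb
begin
definition "comb l (s::ereal) t = ereal l * s + ereal (1 - l) * t"
definition "comb_ok (s::ereal) t \<longleftrightarrow> \<not> (s = \<infinity> \<and> t = -\<infinity>) \<and> \<not> (s = -\<infinity> \<and> t = \<infinity>)"
instance ..
end

instantiation "fun" :: (type, convex_comb) convex_comb
begin
definition "comb l (X::'a \<Rightarrow> 'b) Y = (\<lambda>\<omega>. comb l (X \<omega>) (Y \<omega>))"
definition "comb_ok (X::'a \<Rightarrow> 'b) Y \<longleftrightarrow> (\<forall>\<omega>. comb_ok (X \<omega>) (Y \<omega>))"
instance ..
end

instantiation prod :: (convex_comb, convex_comb) convex_comb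
begin
definition "comb l (a::'a \<times> 'b) b = (comb l (fst a) (fst b), comb l (snd a) (snd b))"
definition "comb_ok (a::'a \<times> 'b) b \<longleftrightarrow> comb_ok (fst a) (fst b) \<and> comb_ok (snd a) (snd b)"
instance ..
end

text \<open>The predicate is meant for \<open>f\<close> that never takes the value \<open>-\<infinity>\<close>, for which the right-hand
  side of the inequality is always well defined.\<close>

definition ext_convex_on :: "'b::convex_comb set \<Rightarrow> ('b \<Rightarrow> ereal) \<Rightarrow> bool" where
  "ext_convex_on S f \<longleftrightarrow>
     (\<forall>a\<in>S. \<forall>b\<in>S. comb_ok a b \<longrightarrow>
        (\<forall>l. 0 < l \<and> l < 1 \<longrightarrow> f (comb l a b) \<le> ereal l * f a + ereal (1 - l) * f b))"

definition ext_quasiconvex_on :: "'b::convex_comb set \<Rightarrow> ('b \<Rightarrow> ereal) \<Rightarrow> bool" where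
  "ext_quasiconvex_on S f \<longleftrightarrow>
     (\<forall>a\<in>S. \<forall>b\<in>S. comb_ok a b \<longrightarrow>
        (\<forall>l. 0 < l \<and> l < 1 \<longrightarrow> f (comb l a b) \<le> max (f a) (f b)))"

end

theory Submission
  imports Defs
begin

text \<open>
  By Hoelder duality, \<open>t + c \<parallel>(X - t)\<^sub>+\<parallel>\<^sub>p\<close> is the maximum of \<open>t (1 - E Z) + E (Z X)\<close> over densities
  \<open>Z \<ge> 0\<close> with \<open>\<parallel>Z\<parallel>\<^sub>q \<le> c\<close>.  Hence it is jointly convex in \<open>(t, X)\<close>, it dominates \<open>EVaR\<close>, and for
  \<open>c > 1\<close> a supporting line of the convex set of points \<open>(E Z, E (Z X))\<close> at abscissa 1 gives a \<open>t\<close>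
  where equality holds; for \<open>c = 1\<close> equality holds in the limit \<open>t \<rightarrow> -\<infinity>\<close>.  Being a minimum of
  functions affine in \<open>c\<close>, \<open>EVaR\<close> is concave in \<open>c\<close>, so right-continuity of \<open>\<Lambda>\<close> yields
  \<open>EVaR (\<Lambda> x\<^sub>0) X \<le> x\<^sub>0\<close> at \<open>x\<^sub>0 = EVaR_Lambda X\<close>, and the maximum defining \<open>T_Lambda\<close> equals \<open>x\<^sub>0\<close>
  at every minimiser \<open>t\<close> of the objective at level \<open>\<Lambda> x\<^sub>0\<close>.
\<close>

section \<open>Hoelder duality\<close>

text \<open>The densities in the dual ball need not have mean 1: \<open>t\<close> is the multiplier
  of that constraint. The radius \<open>(1 / (1 - \<alpha>)) powr (1 / p)\<close> arises because
  \<open>q / p = q - 1\<close> turns the entropy bound \<open>ln (1 / (1 - \<alpha>))\<close> into a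
  bound on the \<open>q\<close>-th moment. Both end levels escape the general argument. At level 0
  the radius is 1, so mean 1 is the largest possible mean instead of an interior one, and the
  minimum may be reached only at \<open>t = - \<infinity>\<close>. At level 1 the coefficient is
  infinite: the penalty becomes the constraint \<open>X \<le> t\<close>, concavity in the
  coefficient says nothing, and a tail event of \<open>X\<close> has to replace it. The supremum
  defining \<open>EVaR_Lambda\<close> controls \<open>EVaR\<close> only at points strictly right of
  its value, hence the appeal to right-continuity. Since \<open>VaR\<close> and
  \<open>VaR_plus\<close> are the infimum and supremum of an arg min, equality at every
  \<open>t\<close> between them requires that arg min to be a closed interval of extended
  reals.\<close>

definition dual_ball :: "'a measure \<Rightarrow> real \<Rightarrow> real \<Rightarrow> ('a \<Rightarrow> real) set" where
  "dual_ball M p c = {Z \<in> borel_measurable M. (\<forall>\<omega>. 0 \<le> Z \<omega>) \<and>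
     (if p = 1 then AE \<omega> in M. Z \<omega> \<le> c
      else integrable M (\<lambda>\<omega>. Z \<omega> powr (p / (p - 1))) \<and>
           (\<integral>\<omega>. Z \<omega> powr (p / (p - 1)) \<partial>M) \<le> c powr (p / (p - 1)))}"

definition excess_norm :: "'a measure \<Rightarrow> real \<Rightarrow> ('a \<Rightarrow> real) \<Rightarrow> real \<Rightarrow> real" where
  "excess_norm M p X t = Lp_norm M p (\<lambda>\<omega>. max (X \<omega> - t) 0)"

lemma conjugate_exponent_real:
  fixes p :: real
  assumes "p > 1"
  shows "p / (p - 1) > 1" "1 / p + 1 / (p / (p - 1)) = 1" "(p - 1) * (p / (p - 1)) = p"
proof -
  show "p / (p - 1) > 1" using assms by (subst less_divide_eq_1_pos) auto
  show "1 / p + 1 / (p / (p - 1)) = 1" using assms by (simp add: diff_divide_distrib)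
  show "(p - 1) * (p / (p - 1)) = p" using assms by simp
qed

text \<open>With a zero endpoint this is \<open>m powr p \<le> m\<close> for \<open>m\<close> in
  [0, 1]; for positive endpoints it is convexity of the power.\<close>

lemma powr_convex_combination:
  fixes p u v l :: real
  assumes "p \<ge> 1" "0 \<le> u" "0 \<le> v" "0 \<le> l" "l \<le> 1"
  shows "(l * u + (1 - l) * v) powr p \<le> l * u powr p + (1 - l) * v powr p"
proof -
  have scale: "(m * w) powr p \<le> m * w powr p" if "0 \<le> m" "m \<le> 1" "0 \<le> w" for m w :: real
  proof -
    have "m powr p \<le> m"
      using powr_mono'[of 1 p m] that assms(1) by (cases "m = 0") auto
    then show ?thesis using that by (simp add: powr_mult mult_right_mono)
  qed
  consider "u = 0" | "v = 0" | "u > 0" "v > 0" using assms by linarith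
  then show ?thesis
  proof cases
    case 1 then show ?thesis using scale[of "1 - l" v] assms by simp
  next
    case 2 then show ?thesis using scale[of l u] assms by simp
  next
    case 3
    then show ?thesis
      using convex_onD[OF powr_convex[OF assms(1)], of l v u] assms
      by (auto simp: algebra_simps)
  qed
qed

section \<open>Elementary properties of \<open>Lp\<close> and of the dual ball\<close>

lemma Lp_D:
  assumes "X \<in> Lp M p"
  shows "X \<in> borel_measurable M" "integrable M (\<lambda>\<omega>. \<bar>X \<omega>\<bar> powr p)"
  using assms by (auto simp: Lp_def)

text \<open>Integrability of the power is a fact of its own: the integral of a non-integrable
  function is 0 and would meet the moment bound vacuously.\<close>

lemma dual_ball_D:
  assumes "Z \<in> dual_ball M p c"
  shows "Z \<in> borel_measurable M" "0 \<le> Z \<omega>"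
    "p = 1 \<Longrightarrow> AE \<omega> in M. Z \<omega> \<le> c"
    "p \<noteq> 1 \<Longrightarrow> integrable M (\<lambda>\<omega>. Z \<omega> powr (p / (p - 1)))"
    "p \<noteq> 1 \<Longrightarrow> (\<integral>\<omega>. Z \<omega> powr (p / (p - 1)) \<partial>M) \<le> c powr (p / (p - 1))"
  using assms by (auto simp: dual_ball_def)

lemma Lp_norm_nonneg: "0 \<le> Lp_norm M p X"
  by (simp add: Lp_norm_def)

lemma Lp_dominated:
  assumes "Y \<in> Lp M p" "X \<in> borel_measurable M" "\<And>\<omega>. \<bar>X \<omega>\<bar> \<le> \<bar>Y \<omega>\<bar>" "p \<ge> 1"
  shows "X \<in> Lp M p"
proof -
  note Lp_D[OF assms(1), measurable] assms(2)[measurable]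
  have "integrable M (\<lambda>\<omega>. \<bar>X \<omega>\<bar> powr p)"
    by (rule Bochner_Integration.integrable_bound[OF Lp_D(2)[OF assms(1)]])
       (use assms(3,4) in \<open>auto intro!: powr_mono2\<close>)
  then show ?thesis using assms(2) by (auto simp: Lp_def)
qed

lemma Lp_cmult:
  assumes "X \<in> Lp M p" "p \<ge> 1"
  shows "(\<lambda>\<omega>. a * X \<omega>) \<in> Lp M p"
  using assms by (auto simp: Lp_def abs_mult powr_mult)

lemma Lp_add:
  assumes "X \<in> Lp M p" "Y \<in> Lp M p" "p \<ge> 1"
  shows "(\<lambda>\<omega>. X \<omega> + Y \<omega>) \<in> Lp M p"
proof -
  note Lp_D(1)[OF assms(1), measurable] Lp_D(1)[OF assms(2), measurable]
  \<comment> \<open>The sum is twice a midpoint, so convexity of the power gives an integrable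
    bound; Minkowski's inequality comes only with \<open>objective_convex\<close>.\<close>
  have bound: "\<bar>X \<omega> + Y \<omega>\<bar> powr p \<le> 2 powr p * (1/2 * \<bar>X \<omega>\<bar> powr p + 1/2 * \<bar>Y \<omega>\<bar> powr p)" for \<omega>
  proof -
    have "\<bar>X \<omega> + Y \<omega>\<bar> powr p \<le> (2 * (1/2 * \<bar>X \<omega>\<bar> + (1 - 1/2) * \<bar>Y \<omega>\<bar>)) powr p"
      using assms(3) by (intro powr_mono2) auto
    also have "\<dots> = 2 powr p * (1/2 * \<bar>X \<omega>\<bar> + (1 - 1/2) * \<bar>Y \<omega>\<bar>) powr p"
      by (subst powr_mult) auto
    also have "\<dots> \<le> 2 powr p * (1/2 * \<bar>X \<omega>\<bar> powr p + (1 - 1/2) * \<bar>Y \<omega>\<bar> powr p)"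
      using assms(3) by (intro mult_left_mono powr_convex_combination) auto
    finally show ?thesis by simp
  qed
  have "integrable M (\<lambda>\<omega>. \<bar>X \<omega> + Y \<omega>\<bar> powr p)"
    by (rule Bochner_Integration.integrable_bound
          [where f = "\<lambda>\<omega>. 2 powr p * (1/2 * \<bar>X \<omega>\<bar> powr p + 1/2 * \<bar>Y \<omega>\<bar> powr p)"])
       (use bound in \<open>auto intro!: Lp_D(2)[OF assms(1)] Lp_D(2)[OF assms(2)]\<close>)
  then show ?thesis by (auto simp: Lp_def)
qed

lemma Lp_norm_powr:
  assumes "p > 0"
  shows "Lp_norm M p X powr p = (\<integral>\<omega>. \<bar>X \<omega>\<bar> powr p \<partial>M)"
  using assms by (simp add: Lp_norm_def powr_powr)

lemma Lp_norm_eq_0_iff: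
  assumes "X \<in> Lp M p"
  shows "Lp_norm M p X = 0 \<longleftrightarrow> (AE \<omega> in M. X \<omega> = 0)"
  using integral_nonneg_eq_0_iff_AE[OF Lp_D(2)[OF assms]]
  by (simp add: Lp_norm_def)

locale Lp_prob_space = prob_space +
  fixes p :: real
  assumes p_ge_1: "p \<ge> 1"
begin

lemma Lp_const: "(\<lambda>_. a) \<in> Lp M p"
  by (auto simp: Lp_def)

lemma Lp_diff_const:
  assumes "X \<in> Lp M p"
  shows "(\<lambda>\<omega>. X \<omega> - t) \<in> Lp M p"
  using Lp_add[OF assms Lp_const[of "-t"] p_ge_1] by simp

lemma Lp_pos_part:
  assumes "X \<in> Lp M p"
  shows "(\<lambda>\<omega>. max (X \<omega>) 0) \<in> Lp M p"
  by (rule Lp_dominated[OF assms]) (use Lp_D(1)[OF assms] p_ge_1 in auto)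

lemma Lp_comb:
  assumes "X \<in> Lp M p" "Y \<in> Lp M p"
  shows "(\<lambda>\<omega>. l * X \<omega> + (1 - l) * Y \<omega>) \<in> Lp M p"
  by (intro Lp_add Lp_cmult assms p_ge_1)

text \<open>For \<open>p = 1\<close> the density is essentially bounded; for \<open>p > 1\<close>
  Young's inequality supplies the integrable majorant.\<close>

lemma Holder_integrable:
  assumes "Y \<in> Lp M p" "Z \<in> dual_ball M p c"
  shows "integrable M (\<lambda>\<omega>. Z \<omega> * Y \<omega>)"
proof (cases "p = 1")
  case True
  note [measurable] = Lp_D(1)[OF assms(1)] dual_ball_D(1)[OF assms(2)]
  have "integrable M (\<lambda>\<omega>. c * \<bar>Y \<omega>\<bar>)"
    using Lp_D(2)[OF assms(1)] True by simp
  then show ?thesis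
  proof (rule Bochner_Integration.integrable_bound)
    show "AE \<omega> in M. norm (Z \<omega> * Y \<omega>) \<le> norm (c * \<bar>Y \<omega>\<bar>)"
      using dual_ball_D(3)[OF assms(2) True] 
    proof eventually_elim
      case (elim \<omega>)
      then show ?case using dual_ball_D(2)[OF assms(2), of \<omega>]
        by (simp add: abs_mult mult_right_mono)
    qed
  qed simp
next
  case False
  note [measurable] = Lp_D(1)[OF assms(1)] dual_ball_D(1)[OF assms(2)]
  have p: "p > 1" using False p_ge_1 by simp
  show ?thesis
  proof (rule Bochner_Integration.integrable_bound)
    show "integrable M (\<lambda>\<omega>. \<bar>Y \<omega>\<bar> powr p / p + Z \<omega> powr (p / (p - 1)) / (p / (p - 1)))"
      by (intro Bochner_Integration.integrable_add integrable_divide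
            Lp_D(2)[OF assms(1)] dual_ball_D(4)[OF assms(2) False])
    show "AE \<omega> in M. norm (Z \<omega> * Y \<omega>)
            \<le> norm (\<bar>Y \<omega>\<bar> powr p / p + Z \<omega> powr (p / (p - 1)) / (p / (p - 1)))"
    proof (rule AE_I2)
      fix \<omega>
      show "norm (Z \<omega> * Y \<omega>)
            \<le> norm (\<bar>Y \<omega>\<bar> powr p / p + Z \<omega> powr (p / (p - 1)) / (p / (p - 1)))"
        using Youngs_inequality[OF p conjugate_exponent_real(1,2)[OF p], of "\<bar>Y \<omega>\<bar>" "Z \<omega>"]
          dual_ball_D(2)[OF assms(2), of \<omega>]
        by (simp add: abs_mult mult.commute)
    qed
  qed simp
qed

text \<open>Replacing \<open>Y\<close> by its positive part only increases the integrand, because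
  \<open>Z \<ge> 0\<close>; the rest is Hoelder's inequality. A vanishing norm is treated apart,
  since the proof divides by it.\<close>

lemma Holder_pos_part:
  assumes "Y \<in> Lp M p" "Z \<in> dual_ball M p c" "c > 0"
  shows "(\<integral>\<omega>. Z \<omega> * Y \<omega> \<partial>M) \<le> c * Lp_norm M p (\<lambda>\<omega>. max (Y \<omega>) 0)"
proof -
  define N where "N = Lp_norm M p (\<lambda>\<omega>. max (Y \<omega>) 0)"
  note Yp = Lp_pos_part[OF assms(1)]
  note intZY = Holder_integrable[OF assms(1,2)]
  note [measurable] = Lp_D(1)[OF assms(1)] dual_ball_D(1)[OF assms(2)]
  note Z0 = dual_ball_D(2)[OF assms(2)]
  have N0: "N \<ge> 0" by (simp add: N_def Lp_norm_nonneg)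
  show ?thesis
  proof (cases "p = 1")
    case True
    have "(\<integral>\<omega>. Z \<omega> * Y \<omega> \<partial>M) \<le> (\<integral>\<omega>. c * max (Y \<omega>) 0 \<partial>M)"
    proof (rule integral_mono_AE[OF intZY])
      show "integrable M (\<lambda>\<omega>. c * max (Y \<omega>) 0)"
        using Lp_D(2)[OF Yp] True by simp
      show "AE \<omega> in M. Z \<omega> * Y \<omega> \<le> c * max (Y \<omega>) 0"
        using dual_ball_D(3)[OF assms(2) True]
      proof eventually_elim
        case (elim \<omega>)
        have "Z \<omega> * Y \<omega> \<le> Z \<omega> * max (Y \<omega>) 0" using Z0 by (intro mult_left_mono) auto
        also have "\<dots> \<le> c * max (Y \<omega>) 0" using elim by (intro mult_right_mono) auto
        finally show ?case .
      qed
    qed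
    also have "\<dots> = c * N"
      using True by (simp add: N_def Lp_norm_def)
    finally show ?thesis by (simp add: N_def)
  next
    case False
    define q where "q = p / (p - 1)"
    have p: "p > 1" using False p_ge_1 by simp
    note q = conjugate_exponent_real[OF p, folded q_def]
    show ?thesis
    proof (cases "N = 0")
      case True
      then have ae: "AE \<omega> in M. max (Y \<omega>) 0 = 0"
        using Lp_norm_eq_0_iff[OF Yp] by (simp add: N_def)
      have "(\<integral>\<omega>. Z \<omega> * Y \<omega> \<partial>M) \<le> (\<integral>\<omega>. 0 \<partial>M)"
      proof (rule integral_mono_AE[OF intZY])
        show "AE \<omega> in M. Z \<omega> * Y \<omega> \<le> 0"
          using ae by eventually_elim (use Z0 in \<open>auto simp: mult_nonneg_nonpos max_def split: if_splits\<close>)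
      qed simp
      then show ?thesis using True by (simp add: N_def)
    next
      case False
      with N0 have Npos: "N > 0" by simp
      \<comment> \<open>Young's majorant for \<open>Y / N\<close> and \<open>Z / c\<close>: after
        this scaling its two terms integrate to \<open>1 / p\<close> and at most
        \<open>1 / q\<close>, which sum to 1.\<close>
      define f where "f \<omega> = c * N * ((max (Y \<omega>) 0) powr p / (N powr p) / p
                        + Z \<omega> powr q / (c powr q) / q)" for \<omega>
      have intp: "integrable M (\<lambda>\<omega>. (max (Y \<omega>) 0) powr p)"
        using Lp_D(2)[OF Yp] by simp
      have intq: "integrable M (\<lambda>\<omega>. Z \<omega> powr q)"
        using dual_ball_D(4)[OF assms(2)] p by (simp add: q_def)
      have intf: "integrable M f"
        unfolding f_def by (intro integrable_mult_right Bochner_Integration.integrable_add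
              integrable_divide intp intq)
      have "Z \<omega> * Y \<omega> \<le> f \<omega>" for \<omega>
      proof -
        have "Z \<omega> * Y \<omega> \<le> Z \<omega> * max (Y \<omega>) 0" using Z0 by (intro mult_left_mono) auto
        also have "\<dots> = c * N * ((max (Y \<omega>) 0 / N) * (Z \<omega> / c))"
          using Npos assms(3) by (simp add: field_simps)
        also have "\<dots> \<le> c * N * ((max (Y \<omega>) 0 / N) powr p / p + (Z \<omega> / c) powr q / q)"
          using Npos assms(3) Z0[of \<omega>]
          by (intro mult_left_mono Youngs_inequality[OF p q(1,2)]) auto
        also have "\<dots> = f \<omega>"
          using Npos assms(3) Z0[of \<omega>] by (simp add: f_def powr_divide)
        finally show ?thesis .
      qed
      then have "(\<integral>\<omega>. Z \<omega> * Y \<omega> \<partial>M) \<le> (\<integral>\<omega>. f \<omega> \<partial>M)"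
        by (intro integral_mono intZY intf)
      also have "\<dots> = c * N * ((\<integral>\<omega>. (max (Y \<omega>) 0) powr p \<partial>M) / (N powr p) / p
                        + (\<integral>\<omega>. Z \<omega> powr q \<partial>M) / (c powr q) / q)"
        unfolding f_def using intp intq by simp
      also have "(\<integral>\<omega>. (max (Y \<omega>) 0) powr p \<partial>M) = N powr p"
        using Lp_norm_powr[of p M "\<lambda>\<omega>. max (Y \<omega>) 0"] p by (simp add: N_def)
      also have "c * N * (N powr p / (N powr p) / p + (\<integral>\<omega>. Z \<omega> powr q \<partial>M) / (c powr q) / q)
                 \<le> c * N * (1 / p + 1 / q)"
      proof -
        have "(\<integral>\<omega>. Z \<omega> powr q \<partial>M) / (c powr q) \<le> 1"
          using dual_ball_D(5)[OF assms(2)] p assms(3) by (simp add: q_def)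
        then have "(\<integral>\<omega>. Z \<omega> powr q \<partial>M) / (c powr q) / q \<le> 1 / q"
          using q(1) by (intro divide_right_mono) auto
        then show ?thesis using Npos assms(3) by (intro mult_left_mono) auto
      qed
      finally show ?thesis using q(2) by (simp add: N_def)
    qed
  qed
qed

text \<open>For \<open>p = 1\<close> this is \<open>c\<close> on \<open>{Y > 0}\<close> and 0 elsewhere, because \<open>0 powr 0 = 0\<close>.  If the norm vanishes,
  division by zero makes it 0.\<close>

definition Holder_extremal :: "real \<Rightarrow> ('a \<Rightarrow> real) \<Rightarrow> 'a \<Rightarrow> real" where
  "Holder_extremal c Y \<omega> =
     c * max (Y \<omega>) 0 powr (p - 1) / Lp_norm M p (\<lambda>\<omega>. max (Y \<omega>) 0) powr (p - 1)"

text \<open>Since \<open>(p - 1) * q = p\<close>, the \<open>q\<close>-th power is a multiple of the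
  \<open>p\<close>-th power of the positive part, scaled to have integral \<open>c powr q\<close>.
  With zero norm the density is 0.\<close>

lemma Holder_extremal_in_dual_ball:
  assumes "Y \<in> Lp M p" "c > 0"
  shows "Holder_extremal c Y \<in> dual_ball M p c"
proof -
  define N where "N = Lp_norm M p (\<lambda>\<omega>. max (Y \<omega>) 0)"
  note Yp = Lp_pos_part[OF assms(1)]
  note [measurable] = Lp_D(1)[OF assms(1)]
  have N0: "N \<ge> 0" by (simp add: N_def Lp_norm_nonneg)
  have meas: "Holder_extremal c Y \<in> borel_measurable M"
    unfolding Holder_extremal_def by measurable
  have nn: "0 \<le> Holder_extremal c Y \<omega>" for \<omega>
    using assms(2) by (simp add: Holder_extremal_def)
  show ?thesis
  proof (cases "p = 1")
    case True
    have "Holder_extremal c Y \<omega> \<le> c" for \<omega>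
      unfolding Holder_extremal_def using assms(2) True by auto
    then show ?thesis using True meas nn by (auto simp: dual_ball_def)
  next
    case False
    define q where "q = p / (p - 1)"
    have p: "p > 1" using False p_ge_1 by simp
    note q = conjugate_exponent_real[OF p, folded q_def]
    have eq: "Holder_extremal c Y \<omega> powr q = c powr q / N powr p * (max (Y \<omega>) 0) powr p" for \<omega>
      using assms(2) q(3) N0
      by (simp add: Holder_extremal_def N_def[symmetric] powr_mult powr_divide powr_powr)
    have intp: "integrable M (\<lambda>\<omega>. (max (Y \<omega>) 0) powr p)"
      using Lp_D(2)[OF Yp] by simp
    have "(\<integral>\<omega>. (max (Y \<omega>) 0) powr p \<partial>M) = N powr p"
      using Lp_norm_powr[of p M "\<lambda>\<omega>. max (Y \<omega>) 0"] p by (simp add: N_def)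
    then have "(\<integral>\<omega>. Holder_extremal c Y \<omega> powr q \<partial>M) \<le> c powr q"
      unfolding eq by (cases "N = 0") auto
    moreover have "integrable M (\<lambda>\<omega>. Holder_extremal c Y \<omega> powr q)"
      unfolding eq using intp by simp
    ultimately show ?thesis using False meas nn by (auto simp: dual_ball_def q_def)
  qed
qed

text \<open>The equality case of Hoelder: one more factor \<open>Y\<close> lifts the exponent
  \<open>p - 1\<close> to \<open>p\<close>, and the density vanishes wherever
  \<open>Y \<le> 0\<close>.\<close>

lemma Holder_extremal_attains:
  assumes "Y \<in> Lp M p" "c > 0"
  shows "(\<integral>\<omega>. Holder_extremal c Y \<omega> * Y \<omega> \<partial>M) = c * Lp_norm M p (\<lambda>\<omega>. max (Y \<omega>) 0)"
proof -
  define N where "N = Lp_norm M p (\<lambda>\<omega>. max (Y \<omega>) 0)"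
  have N0: "N \<ge> 0" by (simp add: N_def Lp_norm_nonneg)
  have "Holder_extremal c Y \<omega> * Y \<omega> = c / N powr (p - 1) * (max (Y \<omega>) 0) powr p" for \<omega>
  proof (cases "Y \<omega> > 0")
    case True
    then have "Y \<omega> powr (p - 1) * Y \<omega> = Y \<omega> powr p"
      by (simp add: powr_diff)
    moreover have "max (Y \<omega>) 0 = Y \<omega>" using True by simp
    ultimately show ?thesis
      by (simp add: Holder_extremal_def N_def mult.assoc)
  next
    case False
    then show ?thesis
      by (simp add: Holder_extremal_def N_def[symmetric] max_def)
  qed
  then have "(\<integral>\<omega>. Holder_extremal c Y \<omega> * Y \<omega> \<partial>M)
     = c / N powr (p - 1) * (\<integral>\<omega>. (max (Y \<omega>) 0) powr p \<partial>M)"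
    by simp
  also have "(\<integral>\<omega>. (max (Y \<omega>) 0) powr p \<partial>M) = N powr p"
    using Lp_norm_powr[of p M "\<lambda>\<omega>. max (Y \<omega>) 0"] p_ge_1 by (simp add: N_def)
  also have "c / N powr (p - 1) * N powr p = c * N"
  proof (cases "N = 0")
    case False
    then show ?thesis using N0 by (simp add: powr_diff field_simps)
  qed simp
  finally show ?thesis by (simp add: N_def)
qed

section \<open>The objective of the minimisation in \<open>t\<close>\<close>

text \<open>Parametrised by the coefficient and not by the level, because the dependence on
  \<open>c\<close> is affine.\<close>

definition objective :: "real \<Rightarrow> ('a \<Rightarrow> real) \<Rightarrow> real \<Rightarrow> real" where
  "objective c X t = t + c * excess_norm M p X t"

lemma excess_norm_nonneg: "0 \<le> excess_norm M p X t"
  by (simp add: excess_norm_def Lp_norm_nonneg)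

lemma dual_ball_integrable:
  assumes "Z \<in> dual_ball M p c"
  shows "integrable M Z"
  using Holder_integrable[OF Lp_const[of 1] assms] by simp

lemma Lp_integrable:
  assumes "X \<in> Lp M p"
  shows "integrable M X"
proof -
  have "(\<lambda>_. 1) \<in> dual_ball M p 1" by (auto simp: dual_ball_def prob_space)
  from Holder_integrable[OF assms this] show ?thesis by simp
qed

lemma dual_ball_const:
  assumes "0 \<le> a" "a \<le> c"
  shows "(\<lambda>_. a) \<in> dual_ball M p c"
  using assms p_ge_1 by (auto simp: dual_ball_def prob_space powr_mono2)

lemma integral_dual_ball_diff_const:
  assumes "X \<in> Lp M p" "Z \<in> dual_ball M p c"
  shows "(\<integral>\<omega>. Z \<omega> * (X \<omega> - t) \<partial>M) = (\<integral>\<omega>. Z \<omega> * X \<omega> \<partial>M) - t * (\<integral>\<omega>. Z \<omega> \<partial>M)"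
proof -
  have "(\<integral>\<omega>. Z \<omega> * (X \<omega> - t) \<partial>M) = (\<integral>\<omega>. Z \<omega> * X \<omega> - t * Z \<omega> \<partial>M)"
    by (simp add: algebra_simps)
  then show ?thesis
    using Holder_integrable[OF assms] dual_ball_integrable[OF assms(2)] by simp
qed

text \<open>This is \<open>Holder_pos_part\<close> for \<open>X - t\<close>. The mean of
  \<open>Z\<close> is arbitrary; at mean 1 the dependence of the left side on \<open>t\<close>
  disappears.\<close>

lemma objective_ge_dual:
  assumes "X \<in> Lp M p" "Z \<in> dual_ball M p c" "c > 0"
  shows "t * (1 - (\<integral>\<omega>. Z \<omega> \<partial>M)) + (\<integral>\<omega>. Z \<omega> * X \<omega> \<partial>M) \<le> objective c X t"
  using Holder_pos_part[OF Lp_diff_const[OF assms(1), of t] assms(2,3)]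
  unfolding integral_dual_ball_diff_const[OF assms(1,2)] objective_def excess_norm_def
  by (simp add: algebra_simps)

lemma objective_eq_dual:
  fixes t :: real
  assumes "X \<in> Lp M p" "c > 0"
  defines "Z \<equiv> Holder_extremal c (\<lambda>\<omega>. X \<omega> - t)"
  shows "Z \<in> dual_ball M p c"
    "objective c X t = t * (1 - (\<integral>\<omega>. Z \<omega> \<partial>M)) + (\<integral>\<omega>. Z \<omega> * X \<omega> \<partial>M)"
proof -
  show Z: "Z \<in> dual_ball M p c"
    unfolding Z_def by (rule Holder_extremal_in_dual_ball[OF Lp_diff_const[OF assms(1)] assms(2)])
  show "objective c X t = t * (1 - (\<integral>\<omega>. Z \<omega> \<partial>M)) + (\<integral>\<omega>. Z \<omega> * X \<omega> \<partial>M)"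
    using Holder_extremal_attains[OF Lp_diff_const[OF assms(1), of t] assms(2), folded Z_def]
    unfolding integral_dual_ball_diff_const[OF assms(1) Z] objective_def excess_norm_def
    by (simp add: algebra_simps)
qed

text \<open>As a maximum of functions that are linear in \<open>(t, X)\<close>, the objective is jointly convex;
  for \<open>c = 1\<close> this contains Minkowski's inequality.\<close>

lemma objective_convex:
  assumes "X \<in> Lp M p" "Y \<in> Lp M p" "c > 0" "0 \<le> l" "l \<le> 1"
  shows "objective c (\<lambda>\<omega>. l * X \<omega> + (1 - l) * Y \<omega>) (l * t + (1 - l) * s)
           \<le> l * objective c X t + (1 - l) * objective c Y s"
proof -
  define W where "W = (\<lambda>\<omega>. l * X \<omega> + (1 - l) * Y \<omega>)"
  define r where "r = l * t + (1 - l) * s"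
  \<comment> \<open>\<open>Z\<close> is optimal at the convex combination but merely admissible at
    its two endpoints, which gives the inequality its direction.\<close>
  define Z where "Z = Holder_extremal c (\<lambda>\<omega>. W \<omega> - r)"
  have W: "W \<in> Lp M p" unfolding W_def by (rule Lp_comb[OF assms(1,2)])
  note Z = objective_eq_dual[OF W assms(3), of r, folded Z_def]
  have "(\<integral>\<omega>. Z \<omega> * W \<omega> \<partial>M) = (\<integral>\<omega>. l * (Z \<omega> * X \<omega>) + (1 - l) * (Z \<omega> * Y \<omega>) \<partial>M)"
    by (simp add: W_def algebra_simps)
  also have "\<dots> = l * (\<integral>\<omega>. Z \<omega> * X \<omega> \<partial>M) + (1 - l) * (\<integral>\<omega>. Z \<omega> * Y \<omega> \<partial>M)"
    using Holder_integrable[OF assms(1) Z(1)] Holder_integrable[OF assms(2) Z(1)] by simp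
  finally have "objective c W r
      = l * (t * (1 - (\<integral>\<omega>. Z \<omega> \<partial>M)) + (\<integral>\<omega>. Z \<omega> * X \<omega> \<partial>M))
        + (1 - l) * (s * (1 - (\<integral>\<omega>. Z \<omega> \<partial>M)) + (\<integral>\<omega>. Z \<omega> * Y \<omega> \<partial>M))"
    using Z(2) by (simp add: r_def algebra_simps)
  also have "\<dots> \<le> l * objective c X t + (1 - l) * objective c Y s"
    using assms(4,5) by (intro add_mono mult_left_mono objective_ge_dual Z(1) assms(1-3)) auto
  finally show ?thesis by (simp add: W_def r_def)
qed

text \<open>The case \<open>c = 1\<close> of joint convexity with the linear terms cancelled; it
  serves level 1, where no finite coefficient exists.\<close>

lemma excess_norm_convex:
  assumes "X \<in> Lp M p" "Y \<in> Lp M p" "0 \<le> l" "l \<le> 1"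
  shows "excess_norm M p (\<lambda>\<omega>. l * X \<omega> + (1 - l) * Y \<omega>) (l * t + (1 - l) * s)
           \<le> l * excess_norm M p X t + (1 - l) * excess_norm M p Y s"
  using objective_convex[OF assms(1,2) zero_less_one assms(3,4), of t s]
  by (simp add: objective_def algebra_simps)

lemma objective_convex_on:
  assumes "X \<in> Lp M p" "c > 0"
  shows "convex_on UNIV (objective c X)"
proof (rule convex_onI)
  fix l x y :: real
  assume "0 < l" "l < 1"
  then show "objective c X ((1 - l) *\<^sub>R x + l *\<^sub>R y)
      \<le> (1 - l) * objective c X x + l * objective c X y"
    using objective_convex[OF assms(1,1,2), of "1 - l" x y] by (simp add: algebra_simps)
qed simp

lemma objective_continuous_on:
  assumes "X \<in> Lp M p" "c > 0"
  shows "continuous_on UNIV (objective c X)"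
  by (rule convex_on_continuous[OF open_UNIV objective_convex_on[OF assms]])

section \<open>Bounds on the objective and its limits as \<open>t\<close> decreases\<close>

lemma objective_ge: "c \<ge> 0 \<Longrightarrow> t \<le> objective c X t"
  by (simp add: objective_def excess_norm_nonneg)

lemma objective_mono_coeff: "c \<le> c' \<Longrightarrow> objective c X t \<le> objective c' X t"
  by (simp add: objective_def excess_norm_nonneg mult_right_mono)

text \<open>The constant density 1 is admissible since \<open>c \<ge> 1\<close>.\<close>

lemma objective_ge_expectation:
  assumes "X \<in> Lp M p" "c \<ge> 1"
  shows "expectation X \<le> objective c X t"
  using objective_ge_dual[OF assms(1) dual_ball_const[of 1 c], of t] assms(2)
  by (simp add: prob_space)

text \<open>A density of norm at most 1 has mean at most 1, so each dual line has slope
  \<open>1 - E Z \<ge> 0\<close>.\<close>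

lemma objective_1_mono:
  assumes "X \<in> Lp M p" "t \<le> s"
  shows "objective 1 X t \<le> objective 1 X s"
proof -
  define Z where "Z = Holder_extremal 1 (\<lambda>\<omega>. X \<omega> - t)"
  note Z = objective_eq_dual[OF assms(1) zero_less_one, of t, folded Z_def]
  have "(\<integral>\<omega>. Z \<omega> \<partial>M) \<le> 1"
    using Holder_pos_part[OF Lp_const[of 1] Z(1)] by (simp add: Lp_norm_def prob_space)
  then have "objective 1 X t \<le> s * (1 - (\<integral>\<omega>. Z \<omega> \<partial>M)) + (\<integral>\<omega>. Z \<omega> * X \<omega> \<partial>M)"
    using assms(2) Z(2) by (simp add: mult_right_mono)
  also have "\<dots> \<le> objective 1 X s"
    by (rule objective_ge_dual[OF assms(1) Z(1)]) simp
  finally show ?thesis .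
qed

text \<open>The constant density \<open>c\<close> has mean above 1 and yields a minorant of negative
  slope \<open>1 - c\<close>.\<close>

lemma objective_at_bot:
  assumes "X \<in> Lp M p" "c > 1"
  shows "filterlim (objective c X) at_top at_bot"
proof (rule filterlim_at_top_mono)
  have "c * expectation X + (1 - c) * t \<le> objective c X t" for t
    using objective_ge_dual[OF assms(1) dual_ball_const[of c c], of t] assms(2)
    by (simp add: prob_space algebra_simps)
  then show "\<forall>\<^sub>F t in at_bot. c * expectation X + (1 - c) * t \<le> objective c X t"
    by simp
  have "filterlim (\<lambda>t::real. (c - 1) * - t) at_top at_bot"
    using assms(2) by (intro filterlim_tendsto_pos_mult_at_top[OF tendsto_const _ filterlim_uminus_at_top_at_bot]) auto
  then have "filterlim (\<lambda>t::real. (1 - c) * t) at_top at_bot"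
    by (simp add: algebra_simps)
  then show "filterlim (\<lambda>t. c * expectation X + (1 - c) * t) at_top at_bot"
    by (intro filterlim_tendsto_add_at_top[OF tendsto_const])
qed

lemma objective_1_at_bot:
  assumes "X \<in> Lp M p"
  shows "(objective 1 X \<longlongrightarrow> expectation X) at_bot"
proof -
  \<comment> \<open>The extremal density is unchanged when its argument is scaled by a positive
    factor; dividing \<open>X + s\<close> by \<open>s\<close> makes it converge pointwise to
    1.\<close>
  define u where "u s \<omega> = max (X \<omega> + s) 0 / s" for s \<omega>
  define r where "r s = (\<integral>\<omega>. u s \<omega> powr p \<partial>M) powr (1 / p)" for s
  note [measurable] = Lp_D(1)[OF assms]
  have [measurable]: "u s \<in> borel_measurable M" for s unfolding u_def by measurable
  have u0: "0 \<le> u s \<omega>" if "s > 0" for s \<omega> using that by (simp add: u_def)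
  have u_le: "u s \<omega> \<le> 1 + \<bar>X \<omega>\<bar>" if "s \<ge> 1" for s \<omega>
  proof -
    have "X \<omega> \<le> \<bar>X \<omega>\<bar> * s" using mult_left_mono[OF that, of "\<bar>X \<omega>\<bar>"] by simp
    then show ?thesis using that by (simp add: u_def divide_le_eq algebra_simps)
  qed
  have u_lim: "((\<lambda>s. u s \<omega>) \<longlongrightarrow> 1) at_top" for \<omega>
  proof (rule Lim_transform_eventually)
    have "((\<lambda>s. max (X \<omega> * inverse s + 1) 0) \<longlongrightarrow> max (X \<omega> * 0 + 1) 0) at_top"
      by (intro tendsto_intros tendsto_inverse_0_at_top filterlim_ident)
    then show "((\<lambda>s. max (X \<omega> * inverse s + 1) 0) \<longlongrightarrow> 1) at_top" by simp
    show "\<forall>\<^sub>F s in at_top. max (X \<omega> * inverse s + 1) 0 = u s \<omega>"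
      using eventually_gt_at_top[of 0]
      by eventually_elim (auto simp: u_def max_def field_simps)
  qed
  have dom: "integrable M (\<lambda>\<omega>. (1 + \<bar>X \<omega>\<bar>) powr p)"
  proof -
    have "(\<lambda>\<omega>. 1 + \<bar>X \<omega>\<bar>) \<in> Lp M p"
      by (intro Lp_add Lp_const p_ge_1 Lp_dominated[OF assms]) auto
    from Lp_D(2)[OF this] show ?thesis by simp
  qed
  have "((\<lambda>s. \<integral>\<omega>. u s \<omega> powr p \<partial>M) \<longlongrightarrow> (\<integral>\<omega>. 1 \<partial>M)) at_top"
  proof (rule integral_dominated_convergence_at_top[OF _ _ dom])
    show "\<forall>\<^sub>F s in at_top. AE \<omega> in M. norm (u s \<omega> powr p) \<le> (1 + \<bar>X \<omega>\<bar>) powr p"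
      using eventually_ge_at_top[of 1]
      by eventually_elim (use u_le u0 p_ge_1 in \<open>auto intro!: powr_mono2\<close>)
    show "AE \<omega> in M. ((\<lambda>s. u s \<omega> powr p) \<longlongrightarrow> 1) at_top"
      using tendsto_powr[OF u_lim tendsto_const[of p]] by simp
  qed auto
  then have "(r \<longlongrightarrow> 1 powr (1 / p)) at_top"
    unfolding r_def by (intro tendsto_powr tendsto_const) (auto simp: prob_space)
  then have r_1: "(r \<longlongrightarrow> 1) at_top" by simp
  have "((\<lambda>s. r s powr (p - 1)) \<longlongrightarrow> 1 powr (p - 1)) at_top"
    by (rule tendsto_powr[OF r_1 tendsto_const]) simp
  then have r_lim: "((\<lambda>s. r s powr (p - 1)) \<longlongrightarrow> 1) at_top" by simp
  have "((\<lambda>s. \<integral>\<omega>. u s \<omega> powr (p - 1) * X \<omega> \<partial>M) \<longlongrightarrow> expectation X) at_top"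
  proof (rule integral_dominated_convergence_at_top[OF _ _ dom])
    show "\<forall>\<^sub>F s in at_top. AE \<omega> in M. norm (u s \<omega> powr (p - 1) * X \<omega>) \<le> (1 + \<bar>X \<omega>\<bar>) powr p"
      using eventually_ge_at_top[of 1]
    proof eventually_elim
      case (elim s)
      have "norm (u s \<omega> powr (p - 1) * X \<omega>) \<le> (1 + \<bar>X \<omega>\<bar>) powr p" for \<omega>
      proof -
        have "norm (u s \<omega> powr (p - 1) * X \<omega>) \<le> (1 + \<bar>X \<omega>\<bar>) powr (p - 1) * (1 + \<bar>X \<omega>\<bar>)"
          using u_le[OF elim, of \<omega>] u0[of s \<omega>] p_ge_1 elim
          by (auto simp: abs_mult intro!: mult_mono powr_mono2)
        also have "\<dots> = (1 + \<bar>X \<omega>\<bar>) powr p"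
          by (simp add: powr_diff)
        finally show ?thesis .
      qed
      then show ?case by simp
    qed
    show "AE \<omega> in M. ((\<lambda>s. u s \<omega> powr (p - 1) * X \<omega>) \<longlongrightarrow> X \<omega>) at_top"
    proof (rule AE_I2)
      fix \<omega>
      have "((\<lambda>s. u s \<omega> powr (p - 1) * X \<omega>) \<longlongrightarrow> 1 powr (p - 1) * X \<omega>) at_top"
        by (intro tendsto_mult tendsto_powr[OF u_lim] tendsto_const) simp
      then show "((\<lambda>s. u s \<omega> powr (p - 1) * X \<omega>) \<longlongrightarrow> X \<omega>) at_top" by simp
    qed
  qed auto
  from tendsto_divide[OF this r_lim]
  have lim: "((\<lambda>s. (\<integral>\<omega>. u s \<omega> powr (p - 1) * X \<omega> \<partial>M) / r s powr (p - 1)) \<longlongrightarrow> expectation X) at_top"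
    by simp
  have upper: "objective 1 X (- s) \<le> (\<integral>\<omega>. u s \<omega> powr (p - 1) * X \<omega> \<partial>M) / r s powr (p - 1)"
    if "s > 0" for s
  proof -
    define Z where "Z = Holder_extremal 1 (\<lambda>\<omega>. X \<omega> - - s)"
    note Z = objective_eq_dual[OF assms zero_less_one, of "- s", folded Z_def]
    have num: "max (X \<omega> - - s) 0 = s * u s \<omega>" for \<omega> using that by (simp add: u_def)
    have den: "Lp_norm M p (\<lambda>\<omega>. max (X \<omega> - - s) 0) = s * r s"
    proof -
      have "\<bar>s * u s \<omega>\<bar> powr p = s powr p * u s \<omega> powr p" for \<omega>
        using that u0[OF that] by (simp add: powr_mult)
      then show ?thesis
        unfolding num Lp_norm_def using that p_ge_1
        by (simp add: r_def powr_mult powr_powr)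
    qed
    have Zeq: "Z \<omega> * X \<omega> = u s \<omega> powr (p - 1) * X \<omega> / r s powr (p - 1)" for \<omega>
      unfolding Z_def Holder_extremal_def den unfolding num
      using that u0[OF that, of \<omega>] by (simp add: powr_mult r_def)
    \<comment> \<open>Hence \<open>- s * (1 - E Z)\<close> is nonpositive and only
      \<open>E (Z X)\<close> remains.\<close>
    have "(\<integral>\<omega>. Z \<omega> \<partial>M) \<le> 1"
      using Holder_pos_part[OF Lp_const[of 1] Z(1)] by (simp add: Lp_norm_def prob_space)
    then have "objective 1 X (- s) \<le> (\<integral>\<omega>. Z \<omega> * X \<omega> \<partial>M)"
      using Z(2) that by simp
    also have "\<dots> = (\<integral>\<omega>. u s \<omega> powr (p - 1) * X \<omega> \<partial>M) / r s powr (p - 1)"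
      unfolding Zeq by simp
    finally show ?thesis .
  qed
  have "((\<lambda>s. objective 1 X (- s)) \<longlongrightarrow> expectation X) at_top"
  proof (rule tendsto_sandwich[OF _ _ tendsto_const lim])
    show "\<forall>\<^sub>F s in at_top. expectation X \<le> objective 1 X (- s)"
      using objective_ge_expectation[OF assms] by simp
    show "\<forall>\<^sub>F s in at_top. objective 1 X (- s)
            \<le> (\<integral>\<omega>. u s \<omega> powr (p - 1) * X \<omega> \<partial>M) / r s powr (p - 1)"
      using eventually_gt_at_top[of 0] by eventually_elim (rule upper)
  qed
  then show ?thesis by (simp add: filterlim_at_bot_mirror)
qed

section \<open>Dual representation\<close>

lemma dual_ball_convex:
  assumes "Z \<in> dual_ball M p c" "W \<in> dual_ball M p c" "0 \<le> l" "l \<le> 1"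
  shows "(\<lambda>\<omega>. l * Z \<omega> + (1 - l) * W \<omega>) \<in> dual_ball M p c"
proof -
  define V where "V = (\<lambda>\<omega>. l * Z \<omega> + (1 - l) * W \<omega>)"
  note [measurable] = dual_ball_D(1)[OF assms(1)] dual_ball_D(1)[OF assms(2)]
  have V: "V \<in> borel_measurable M" unfolding V_def by measurable
  have V0: "0 \<le> V \<omega>" for \<omega>
    using dual_ball_D(2)[OF assms(1), of \<omega>] dual_ball_D(2)[OF assms(2), of \<omega>] assms(3,4)
    by (simp add: V_def)
  have "V \<in> dual_ball M p c"
  proof (cases "p = 1")
    case True
    have "AE \<omega> in M. V \<omega> \<le> c"
      using dual_ball_D(3)[OF assms(1) True] dual_ball_D(3)[OF assms(2) True]
    proof eventually_elim
      case (elim \<omega>)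
      have "V \<omega> \<le> l * c + (1 - l) * c"
        using elim assms(3,4) unfolding V_def by (intro add_mono mult_left_mono) auto
      then show ?case by (simp add: algebra_simps)
    qed
    then show ?thesis using True V V0 by (auto simp: dual_ball_def)
  next
    case False
    define q where "q = p / (p - 1)"
    have p: "p > 1" using False p_ge_1 by simp
    have q: "q \<ge> 1" using conjugate_exponent_real(1)[OF p] by (simp add: q_def)
    note iZ = dual_ball_D(4)[OF assms(1) False, folded q_def]
      and iW = dual_ball_D(4)[OF assms(2) False, folded q_def]
    have le: "V \<omega> powr q \<le> l * Z \<omega> powr q + (1 - l) * W \<omega> powr q" for \<omega>
      unfolding V_def
      using dual_ball_D(2)[OF assms(1)] dual_ball_D(2)[OF assms(2)] assms(3,4) q
      by (intro powr_convex_combination) auto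
    have int: "integrable M (\<lambda>\<omega>. l * Z \<omega> powr q + (1 - l) * W \<omega> powr q)"
      using iZ iW by simp
    have iV: "integrable M (\<lambda>\<omega>. V \<omega> powr q)"
      by (rule Bochner_Integration.integrable_bound[OF int])
         (use V le assms(3,4) in auto)
    have "(\<integral>\<omega>. V \<omega> powr q \<partial>M) \<le> (\<integral>\<omega>. l * Z \<omega> powr q + (1 - l) * W \<omega> powr q \<partial>M)"
      by (intro integral_mono iV int le)
    also have "\<dots> = l * (\<integral>\<omega>. Z \<omega> powr q \<partial>M) + (1 - l) * (\<integral>\<omega>. W \<omega> powr q \<partial>M)"
      using iZ iW by simp
    also have "\<dots> \<le> l * (c powr q) + (1 - l) * (c powr q)"
      using dual_ball_D(5)[OF assms(1) False] dual_ball_D(5)[OF assms(2) False] assms(3,4)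
      by (intro add_mono mult_left_mono) (auto simp: q_def)
    finally have "(\<integral>\<omega>. V \<omega> powr q \<partial>M) \<le> c powr q" by (simp add: algebra_simps)
    then show ?thesis using False V V0 iV by (auto simp: dual_ball_def q_def)
  qed
  then show ?thesis by (simp add: V_def)
qed

text \<open>The points \<open>(E Z, E (Z X))\<close> form a convex set whose fibre over 1 lies below \<open>s\<close>, and 1 is an
  interior point of its projection because \<open>c > 1\<close>.  A line through \<open>(1, s)\<close> above this set has
  slope \<open>t\<close>.\<close>

lemma objective_attains:
  assumes X: "X \<in> Lp M p" and c: "c > 1"
    and s: "\<And>Z. Z \<in> dual_ball M p c \<Longrightarrow> expectation Z = 1 \<Longrightarrow> (\<integral>\<omega>. Z \<omega> * X \<omega> \<partial>M) \<le> s"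
  shows "\<exists>t. objective c X t \<le> s"
proof -
  define a where "a Z = expectation Z" for Z :: "'a \<Rightarrow> real"
  define b where "b Z = (\<integral>\<omega>. Z \<omega> * X \<omega> \<partial>M)" for Z :: "'a \<Rightarrow> real"
  define D where "D = {Z \<in> dual_ball M p c. a Z > 1}"
  \<comment> \<open>Chords to \<open>(1, s)\<close> from points of mean above 1 and of mean below 1
    have ordered slopes; any number between them is a supporting slope.\<close>
  have cross: "(b Z - s) / (a Z - 1) \<le> (s - b W) / (1 - a W)"
    if Z: "Z \<in> dual_ball M p c" "a Z > 1" and W: "W \<in> dual_ball M p c" "a W < 1" for Z W
  proof -
    \<comment> \<open>The weight for which the mixture of \<open>Z\<close> and \<open>W\<close> has
      mean exactly 1, so that the hypothesis on \<open>s\<close> applies to it.\<close>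
    define l where "l = (1 - a W) / (a Z - a W)"
    have l: "0 \<le> l" "l \<le> 1" "1 - l = (a Z - 1) / (a Z - a W)"
      using Z(2) W(2) by (auto simp: l_def field_simps)
    define V where "V = (\<lambda>\<omega>. l * Z \<omega> + (1 - l) * W \<omega>)"
    have V: "V \<in> dual_ball M p c"
      unfolding V_def by (rule dual_ball_convex[OF Z(1) W(1) l(1,2)])
    have "a V = l * a Z + (1 - l) * a W"
      unfolding a_def V_def using dual_ball_integrable[OF Z(1)] dual_ball_integrable[OF W(1)] by simp
    also have "\<dots> = 1"
      unfolding l(3) using Z(2) W(2) by (simp add: l_def divide_simps) (simp add: algebra_simps)
    finally have "b V \<le> s" using s[OF V] by (simp add: a_def b_def)
    moreover have "b V = (\<integral>\<omega>. l * (Z \<omega> * X \<omega>) + (1 - l) * (W \<omega> * X \<omega>) \<partial>M)"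
      by (simp add: b_def V_def algebra_simps)
    then have "b V = l * b Z + (1 - l) * b W"
      using Holder_integrable[OF X Z(1)] Holder_integrable[OF X W(1)] by (simp add: b_def)
    ultimately have "l * b Z + (1 - l) * b W \<le> s" by simp
    then have "(1 - a W) * b Z + (a Z - 1) * b W \<le> s * (a Z - a W)"
      using Z(2) W(2) unfolding l(3)
      by (simp add: l_def pos_divide_le_eq add_divide_distrib[symmetric])
    then show ?thesis
      using Z(2) W(2) by (simp add: divide_simps) (simp add: algebra_simps)
  qed
  define t where "t = (SUP Z\<in>D. (b Z - s) / (a Z - 1))"
  \<comment> \<open>The constants 0 and \<open>c\<close> lie on either side of mean 1, so the
    supremum \<open>t\<close> is bounded above and over a nonempty set. Here \<open>c > 1\<close>
    enters.\<close>
  have zero: "(\<lambda>_. 0) \<in> dual_ball M p c" "a (\<lambda>_. 0) < 1"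
    using dual_ball_const[of 0 c] c by (auto simp: a_def)
  have "(\<lambda>_. c) \<in> D"
    using dual_ball_const[of c c] c by (auto simp: a_def D_def prob_space)
  then have D: "D \<noteq> {}" by auto
  have bdd: "bdd_above ((\<lambda>Z. (b Z - s) / (a Z - 1)) ` D)"
    by (rule bdd_aboveI2) (use cross[OF _ _ zero] in \<open>auto simp: D_def\<close>)
  have all: "t * (1 - a Z) + b Z \<le> s" if Z: "Z \<in> dual_ball M p c" for Z
  proof -
    consider "a Z = 1" | "a Z > 1" | "a Z < 1" by linarith
    then show ?thesis
    proof cases
      case 1 then show ?thesis using s[OF Z] by (simp add: a_def b_def)
    next
      case 2
      then have "(b Z - s) / (a Z - 1) \<le> t"
        unfolding t_def using Z by (intro cSUP_upper bdd) (auto simp: D_def)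
      then show ?thesis using 2 by (simp add: pos_divide_le_eq algebra_simps)
    next
      case 3
      have "t \<le> (s - b Z) / (1 - a Z)"
        unfolding t_def by (intro cSUP_least D) (use cross[OF _ _ Z 3] in \<open>auto simp: D_def\<close>)
      then show ?thesis using 3 by (simp add: pos_le_divide_eq algebra_simps)
    qed
  qed
  \<comment> \<open>The bound holds for every \<open>Z\<close>, in particular for the extremal one
    at \<open>t\<close>, whose dual value is the objective.\<close>
  have "objective c X t \<le> s"
    using objective_eq_dual[OF X, of c t] all[of "Holder_extremal c (\<lambda>\<omega>. X \<omega> - t)"] c
    by (simp add: a_def b_def)
  then show ?thesis ..
qed

text \<open>With \<open>\<beta> = 1 / (1 - \<alpha>)\<close>, exponentiating gives a
  \<open>q\<close>-th moment of at most \<open>\<beta> powr (q - 1)\<close>, which is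
  \<open>(\<beta> powr (1 / p)) powr q\<close>. For \<open>p = 1\<close> both sides say that
  \<open>Z\<close> is essentially bounded by \<open>\<beta>\<close>.\<close>

lemma renyi_entropy_density_le_iff:
  assumes [measurable]: "Z \<in> borel_measurable M" and Z0: "\<And>\<omega>. 0 \<le> Z \<omega>"
    and int: "integrable M Z" "expectation Z = 1"
    and \<alpha>: "0 \<le> \<alpha>" "\<alpha> < 1"
  shows "renyi_entropy M (conjugate_exponent p) (density M (\<lambda>\<omega>. ennreal (Z \<omega>)))
           \<le> ereal (ln (1 / (1 - \<alpha>)))
         \<longleftrightarrow> Z \<in> dual_ball M p ((1 / (1 - \<alpha>)) powr (1 / p))"
proof -
  define Q where "Q = density M (\<lambda>\<omega>. ennreal (Z \<omega>))"
  define \<beta> where "\<beta> = 1 / (1 - \<alpha>)"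
  have \<beta>: "\<beta> > 0" using \<alpha> by (simp add: \<beta>_def)
  have ac: "absolutely_continuous M Q" unfolding Q_def by (rule absolutely_continuousI_density) simp
  have rn: "AE \<omega> in M. ennreal (Z \<omega>) = RN_deriv M Q \<omega>"
    by (rule RN_deriv_unique) (auto simp: Q_def)
  \<comment> \<open>Mean 1 keeps the essential supremum and the moment positive, where
    \<open>ln\<close> is strictly increasing.\<close>
  have Z_not_0: "\<not> (AE \<omega> in M. Z \<omega> = 0)"
    using integral_nonneg_eq_0_iff_AE[OF int(1)] Z0 int(2) by auto
  have "renyi_entropy M (conjugate_exponent p) Q \<le> ereal (ln \<beta>)
         \<longleftrightarrow> Z \<in> dual_ball M p (\<beta> powr (1 / p))"
  proof (cases "p = 1")
    case True
    define e where "e = esssup M (\<lambda>\<omega>. ennreal (Z \<omega>))"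
    have e: "esssup M (RN_deriv M Q) = e"
      unfolding e_def by (rule esssup_AE_cong) (use rn in auto)
    have ae_le: "AE \<omega> in M. ennreal (Z \<omega>) \<le> e" unfolding e_def by (rule esssup_AE)
    have e_pos: "enn2real e > 0" if "e < \<infinity>"
    proof (rule ccontr)
      assume "\<not> enn2real e > 0"
      then have "e = 0"
        using that by (metis enn2real_nonneg enn2real_eq_0_iff less_le infinity_ennreal_def less_irrefl)
      then have "AE \<omega> in M. Z \<omega> = 0"
        using ae_le by (auto elim!: eventually_mono simp: Z0 intro: antisym)
      then show False using Z_not_0 by simp
    qed
    have "(e < \<infinity> \<and> ln (enn2real e) \<le> ln \<beta>) \<longleftrightarrow> (AE \<omega> in M. Z \<omega> \<le> \<beta>)"
    proof
      assume *: "e < \<infinity> \<and> ln (enn2real e) \<le> ln \<beta>"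
      then have "enn2real e \<le> \<beta>" using e_pos \<beta> by simp
      then have "e \<le> ennreal \<beta>"
        using * by (metis ennreal_enn2real_if ennreal_leI infinity_ennreal_def less_irrefl)
      then have "AE \<omega> in M. ennreal (Z \<omega>) \<le> ennreal \<beta>"
        using ae_le by (auto elim!: eventually_mono)
      then show "AE \<omega> in M. Z \<omega> \<le> \<beta>"
        by (rule eventually_mono) (use \<beta> in auto)
    next
      assume "AE \<omega> in M. Z \<omega> \<le> \<beta>"
      then have "AE \<omega> in M. ennreal (Z \<omega>) \<le> ennreal \<beta>"
        by (rule eventually_mono) (rule ennreal_leI)
      then have le: "e \<le> ennreal \<beta>" unfolding e_def by (intro esssup_I) auto
      then have fin: "e < \<infinity>" by (simp add: le_less_trans)
      have "enn2real e \<le> \<beta>" using le \<beta> by (metis enn2real_leI less_imp_le)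
      then show "e < \<infinity> \<and> ln (enn2real e) \<le> ln \<beta>" using fin e_pos by simp
    qed
    then show ?thesis
      using True ac \<beta> Z0
      by (auto simp: renyi_entropy_def conjugate_exponent_def e dual_ball_def)
  next
    case False
    define q where "q = p / (p - 1)"
    have p: "p > 1" using False p_ge_1 by simp
    have q: "q > 1" "1 / p * q = q - 1"
      using conjugate_exponent_real(1)[OF p] p by (auto simp: q_def field_simps)
    have aeq: "AE \<omega> in M. enn2real (RN_deriv M Q \<omega>) powr q = Z \<omega> powr q"
      using rn by eventually_elim (metis Z0 enn2real_ennreal)
    have i: "integrable M (\<lambda>\<omega>. enn2real (RN_deriv M Q \<omega>) powr q) \<longleftrightarrow> integrable M (\<lambda>\<omega>. Z \<omega> powr q)"
      by (rule integrable_cong_AE) (use aeq in auto)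
    have I: "(\<integral>\<omega>. enn2real (RN_deriv M Q \<omega>) powr q \<partial>M) = (\<integral>\<omega>. Z \<omega> powr q \<partial>M)"
      by (rule integral_cong_AE) (use aeq in auto)
    have "(1 / (q - 1) * ln (\<integral>\<omega>. Z \<omega> powr q \<partial>M) \<le> ln \<beta>)
        \<longleftrightarrow> (\<integral>\<omega>. Z \<omega> powr q \<partial>M) \<le> (\<beta> powr (1 / p)) powr q"
      if "integrable M (\<lambda>\<omega>. Z \<omega> powr q)"
    proof -
      have "(\<integral>\<omega>. Z \<omega> powr q \<partial>M) \<noteq> 0"
        using integral_nonneg_eq_0_iff_AE[OF that] Z_not_0 by simp
      moreover have "(\<integral>\<omega>. Z \<omega> powr q \<partial>M) \<ge> 0" by simp
      ultimately have pos: "(\<integral>\<omega>. Z \<omega> powr q \<partial>M) > 0" by linarith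
      have "(1 / (q - 1) * ln (\<integral>\<omega>. Z \<omega> powr q \<partial>M) \<le> ln \<beta>)
          \<longleftrightarrow> ln (\<integral>\<omega>. Z \<omega> powr q \<partial>M) \<le> ln (\<beta> powr (q - 1))"
        using q \<beta> by (simp add: ln_powr field_simps)
      also have "\<dots> \<longleftrightarrow> (\<integral>\<omega>. Z \<omega> powr q \<partial>M) \<le> \<beta> powr (q - 1)"
        using pos \<beta> by (intro ln_le_cancel_iff) auto
      also have "\<beta> powr (q - 1) = (\<beta> powr (1 / p)) powr q"
        unfolding powr_powr q(2) ..
      finally show ?thesis .
    qed
    then show ?thesis
      using False ac Z0
      by (simp add: renyi_entropy_def conjugate_exponent_def Let_def i I dual_ball_def
          flip: q_def)
  qed
  then show ?thesis by (simp add: Q_def \<beta>_def)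
qed

text \<open>Radon-Nikodym exchanges measures for densities; a finite entropy bound already enforces
  absolute continuity.\<close>

lemma EVaR_eq_Sup_dual:
  assumes X: "X \<in> Lp M p" and \<alpha>: "0 \<le> \<alpha>" "\<alpha> < 1"
  shows "EVaR M p \<alpha> X = Sup {ereal (\<integral>\<omega>. Z \<omega> * X \<omega> \<partial>M) | Z.
           Z \<in> dual_ball M p ((1 / (1 - \<alpha>)) powr (1 / p)) \<and> expectation Z = 1}"
    (is "_ = Sup ?R")
proof -
  note [measurable] = Lp_D(1)[OF X]
  define L where "L = {ereal (\<integral>\<omega>. X \<omega> \<partial>Q) | Q.
             prob_space Q \<and> sets Q = sets M \<and>
             renyi_entropy M (conjugate_exponent p) Q \<le> ereal (ln (1 / (1 - \<alpha>)))}"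
  have "L = ?R"
  proof (intro equalityI subsetI)
    fix v assume "v \<in> L"
    then obtain Q where Q: "prob_space Q" "sets Q = sets M"
      "renyi_entropy M (conjugate_exponent p) Q \<le> ereal (ln (1 / (1 - \<alpha>)))"
      and v: "v = ereal (\<integral>\<omega>. X \<omega> \<partial>Q)" by (auto simp: L_def)
    interpret Q: prob_space Q by fact
    have ac: "absolutely_continuous M Q"
      using Q(3) by (auto simp: renyi_entropy_def split: if_splits)
    define Z where "Z \<omega> = enn2real (RN_deriv M Q \<omega>)" for \<omega>
    have Zm[measurable]: "Z \<in> borel_measurable M" unfolding Z_def by measurable
    have Z0: "0 \<le> Z \<omega>" for \<omega> by (simp add: Z_def)
    have dens: "Q = density M (\<lambda>\<omega>. ennreal (Z \<omega>))"
    proof -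
      have "density M (RN_deriv M Q) = density M (\<lambda>\<omega>. ennreal (Z \<omega>))"
        using RN_deriv_finite[OF Q.sigma_finite_measure_axioms ac Q(2)]
        by (intro density_cong) (auto elim!: eventually_mono simp: Z_def less_top)
      then show ?thesis using density_RN_deriv[OF ac Q(2)] by simp
    qed
    have "emeasure Q (space Q) = (\<integral>\<^sup>+\<omega>. ennreal (Z \<omega>) \<partial>M)"
      by (subst (1 2) dens) (simp add: emeasure_density nn_integral_set_ennreal cong: nn_integral_cong)
    then have nn: "(\<integral>\<^sup>+\<omega>. ennreal (Z \<omega>) \<partial>M) = 1" by (simp add: Q.emeasure_space_1)
    have int: "integrable M Z"
      by (rule integrableI_nonneg) (use nn Z0 in auto)
    have E: "expectation Z = 1"
      using nn_integral_eq_integral[OF int] nn Z0 by simp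
    have "Z \<in> dual_ball M p ((1 / (1 - \<alpha>)) powr (1 / p))"
      using renyi_entropy_density_le_iff[OF Zm Z0 int E \<alpha>] Q(3) dens by simp
    moreover have "(\<integral>\<omega>. X \<omega> \<partial>Q) = (\<integral>\<omega>. Z \<omega> * X \<omega> \<partial>M)"
      by (subst dens, subst integral_density) (use Z0 in auto)
    ultimately show "v \<in> ?R" using v E by auto
  next
    fix v assume "v \<in> ?R"
    then obtain Z where Z: "Z \<in> dual_ball M p ((1 / (1 - \<alpha>)) powr (1 / p))" "expectation Z = 1"
      and v: "v = ereal (\<integral>\<omega>. Z \<omega> * X \<omega> \<partial>M)" by auto
    note Zm[measurable] = dual_ball_D(1)[OF Z(1)] and Z0 = dual_ball_D(2)[OF Z(1)]
      and int = dual_ball_integrable[OF Z(1)]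
    define Q where "Q = density M (\<lambda>\<omega>. ennreal (Z \<omega>))"
    have "emeasure Q (space Q) = (\<integral>\<^sup>+\<omega>. ennreal (Z \<omega>) \<partial>M)"
      by (simp add: Q_def emeasure_density cong: nn_integral_cong)
    also have "\<dots> = 1"
      using nn_integral_eq_integral[OF int] Z0 Z(2) by simp
    finally have "prob_space Q" by (rule prob_spaceI)
    moreover have "sets Q = sets M" by (simp add: Q_def)
    moreover have "renyi_entropy M (conjugate_exponent p) Q \<le> ereal (ln (1 / (1 - \<alpha>)))"
      unfolding Q_def using renyi_entropy_density_le_iff[OF Zm Z0 int Z(2) \<alpha>] Z(1) by simp
    moreover have "(\<integral>\<omega>. X \<omega> \<partial>Q) = (\<integral>\<omega>. Z \<omega> * X \<omega> \<partial>M)"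
      unfolding Q_def by (subst integral_density) (use Z0 in auto)
    ultimately show "v \<in> L" unfolding L_def v by (metis (mono_tags, lifting) mem_Collect_eq)
  qed
  then show ?thesis using \<alpha> by (simp add: EVaR_def L_def)
qed

section \<open>Minimisers\<close>

text \<open>Meaningful below level 1 only: at 1 division by zero makes it 0, whereas
  \<open>level_coeff\<close> is infinite there.\<close>

definition coeff :: "real \<Rightarrow> real" where
  "coeff \<alpha> = (1 / (1 - \<alpha>)) powr (1 / p)"

lemma level_coeff_eq: "\<alpha> \<noteq> 1 \<Longrightarrow> level_coeff p \<alpha> = ereal (coeff \<alpha>)"
  by (simp add: level_coeff_def coeff_def)

lemma coeff_mono: "\<alpha> \<le> \<beta> \<Longrightarrow> \<beta> < 1 \<Longrightarrow> coeff \<alpha> \<le> coeff \<beta>"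
  unfolding coeff_def using p_ge_1 by (intro powr_mono2) (auto simp: field_simps)

lemma coeff_strict_mono: "\<alpha> < \<beta> \<Longrightarrow> \<beta> < 1 \<Longrightarrow> coeff \<alpha> < coeff \<beta>"
  unfolding coeff_def using p_ge_1 by (intro powr_less_mono2) (auto simp: field_simps)

lemma coeff_0 [simp]: "coeff 0 = 1"
  by (simp add: coeff_def)

lemma coeff_ge_1: "0 \<le> \<alpha> \<Longrightarrow> \<alpha> < 1 \<Longrightarrow> 1 \<le> coeff \<alpha>"
  using coeff_mono[of 0 \<alpha>] by simp

lemma coeff_gt_1: "0 < \<alpha> \<Longrightarrow> \<alpha> < 1 \<Longrightarrow> 1 < coeff \<alpha>"
  using coeff_strict_mono[of 0 \<alpha>] by simp

lemma excess_norm_eq_0_iff: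
  assumes "X \<in> Lp M p"
  shows "excess_norm M p X t = 0 \<longleftrightarrow> (AE \<omega> in M. X \<omega> \<le> t)"
proof -
  have "excess_norm M p X t = 0 \<longleftrightarrow> (AE \<omega> in M. max (X \<omega> - t) 0 = 0)"
    unfolding excess_norm_def by (rule Lp_norm_eq_0_iff[OF Lp_pos_part[OF Lp_diff_const[OF assms]]])
  also have "\<dots> \<longleftrightarrow> (AE \<omega> in M. X \<omega> \<le> t)"
    by (intro AE_cong) (auto simp: max_def)
  finally show ?thesis .
qed

section \<open>The objective on extended reals, including infinite \<open>t\<close> and level
  1\<close>

lemma evar_objective_real_eq:
  "evar_objective_real M p \<alpha> X t = ereal t + level_coeff p \<alpha> * ereal (excess_norm M p X t)"
  by (simp add: evar_objective_real_def excess_norm_def)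

lemma evar_objective_ereal [simp]:
  "evar_objective M p \<alpha> X (ereal t) = ereal t + level_coeff p \<alpha> * ereal (excess_norm M p X t)"
  by (simp add: evar_objective_def evar_objective_real_eq)

lemma evar_objective_lt_1:
  "\<alpha> \<noteq> 1 \<Longrightarrow> evar_objective M p \<alpha> X (ereal t) = ereal (objective (coeff \<alpha>) X t)"
  by (simp add: level_coeff_eq objective_def)

lemma evar_objective_1:
  "evar_objective M p 1 X (ereal t) = (if excess_norm M p X t = 0 then ereal t else \<infinity>)"
  using excess_norm_nonneg[of X t] by (auto simp: level_coeff_def less_le)

lemma evar_objective_real_ge:
  assumes "\<alpha> \<in> {0..1}"
  shows "ereal t \<le> evar_objective_real M p \<alpha> X t"
proof (cases "\<alpha> = 1")
  case True
  then show ?thesis using evar_objective_1[of X t] by (auto simp: evar_objective_real_eq)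
next
  case False
  then show ?thesis
    using excess_norm_nonneg[of X t] coeff_ge_1[of \<alpha>] assms
    by (simp add: evar_objective_real_eq level_coeff_eq)
qed

lemma evar_objective_PInf [simp]:
  assumes "\<alpha> \<in> {0..1}"
  shows "evar_objective M p \<alpha> X \<infinity> = \<infinity>"
proof -
  have "(evar_objective_real M p \<alpha> X \<longlongrightarrow> \<infinity>) at_top"
    unfolding tendsto_PInfty
  proof
    fix r
    show "\<forall>\<^sub>F t in at_top. ereal r < evar_objective_real M p \<alpha> X t"
      using eventually_gt_at_top[of r]
    proof eventually_elim
      case (elim t)
      then have "ereal r < ereal t" by simp
      also have "\<dots> \<le> evar_objective_real M p \<alpha> X t" by (rule evar_objective_real_ge[OF assms])
      finally show ?case .
    qed
  qed
  then show ?thesis by (simp add: evar_objective_def tendsto_Lim)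
qed

text \<open>The limit at \<open>- \<infinity>\<close> depends on whether the coefficient is 1,
  finite and larger, or infinite; only the first gives a finite value.\<close>

lemma evar_objective_MInf:
  assumes "X \<in> Lp M p" "\<alpha> \<in> {0..1}"
  shows "evar_objective M p \<alpha> X (- \<infinity>) = (if \<alpha> = 0 then ereal (expectation X) else \<infinity>)"
proof -
  consider "\<alpha> = 0" | "0 < \<alpha>" "\<alpha> < 1" | "\<alpha> = 1" using assms(2) by force
  then have "(evar_objective_real M p \<alpha> X \<longlongrightarrow> (if \<alpha> = 0 then ereal (expectation X) else \<infinity>)) at_bot"
  proof cases
    case 1
    then have "evar_objective_real M p \<alpha> X = (\<lambda>t. ereal (objective 1 X t))"
      by (simp add: fun_eq_iff evar_objective_real_eq level_coeff_eq objective_def)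
    then show ?thesis using 1 objective_1_at_bot[OF assms(1)] by simp
  next
    case 2
    then have "evar_objective_real M p \<alpha> X = (\<lambda>t. ereal (objective (coeff \<alpha>) X t))"
      by (simp add: fun_eq_iff evar_objective_real_eq level_coeff_eq objective_def)
    then show ?thesis
      using 2 objective_at_bot[OF assms(1) coeff_gt_1[OF 2]] by (simp add: tendsto_PInfty_eq_at_top)
  next
    case 3
    have "\<forall>\<^sub>F t in at_bot. evar_objective_real M p \<alpha> X t = \<infinity>"
      using eventually_gt_at_bot[of "expectation X"]
    proof eventually_elim
      case (elim t)
      \<comment> \<open>Below the mean the constraint of level 1 fails, so the objective is
        constantly infinite near \<open>- \<infinity>\<close>.\<close>
      have "\<not> (AE \<omega> in M. X \<omega> \<le> t)"
        using integral_mono_AE[OF Lp_integrable[OF assms(1)], of "\<lambda>_. t"] elim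
        by (auto simp: prob_space)
      then have "excess_norm M p X t \<noteq> 0" using excess_norm_eq_0_iff[OF assms(1)] by simp
      then show ?case using 3 evar_objective_1[of X t] by (simp add: evar_objective_real_eq)
    qed
    then show ?thesis using 3 by (simp add: tendsto_eventually)
  qed
  then show ?thesis by (simp add: evar_objective_def tendsto_Lim)
qed

lemma evar_objective_mono:
  assumes "X \<in> Lp M p" "0 \<le> \<alpha>" "\<alpha> \<le> \<beta>" "\<beta> \<le> 1"
  shows "evar_objective M p \<alpha> X t \<le> evar_objective M p \<beta> X t"
proof (cases t)
  case (real r)
  show ?thesis
  proof (cases "\<beta> = 1")
    case True
    then show ?thesis
      unfolding real True evar_objective_1
      by (auto simp: zero_ereal_def[symmetric])
  next
    case False
    then show ?thesis
      using assms coeff_mono[of \<alpha> \<beta>]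
      by (simp add: real evar_objective_lt_1 objective_mono_coeff del: evar_objective_ereal)
  qed
next
  case MInf
  then show ?thesis using assms by (simp add: evar_objective_MInf)
qed (use assms in simp)

lemma evar_objective_ge_expectation:
  assumes "X \<in> Lp M p" "\<alpha> \<in> {0..1}"
  shows "ereal (expectation X) \<le> evar_objective M p \<alpha> X t"
proof -
  have "ereal (expectation X) \<le> evar_objective M p 0 X t"
    by (cases t) (auto simp: evar_objective_lt_1 evar_objective_MInf assms(1)
        objective_ge_expectation[OF assms(1)] simp del: evar_objective_ereal)
  also have "\<dots> \<le> evar_objective M p \<alpha> X t"
    using assms by (intro evar_objective_mono) auto
  finally show ?thesis .
qed

lemma ess_sup_le_iff:
  assumes "X \<in> Lp M p"
  shows "ess_sup M X \<le> ereal t \<longleftrightarrow> (AE \<omega> in M. X \<omega> \<le> t)"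
proof
  assume le: "ess_sup M X \<le> ereal t"
  show "AE \<omega> in M. X \<omega> \<le> t"
    using esssup_AE[of "\<lambda>\<omega>. ereal (X \<omega>)" M]
  proof eventually_elim
    case (elim \<omega>)
    then have "ereal (X \<omega>) \<le> ereal t" using le unfolding ess_sup_def by (rule order_trans)
    then show ?case by simp
  qed
next
  assume "AE \<omega> in M. X \<omega> \<le> t"
  then show "ess_sup M X \<le> ereal t"
    using Lp_D(1)[OF assms] by (auto simp: ess_sup_def)
qed

lemma ess_sup_ge_expectation:
  assumes "X \<in> Lp M p"
  shows "ereal (expectation X) \<le> ess_sup M X"
\<comment> \<open>The essential supremum may be infinite; comparing with points strictly above it
  leaves only a real bound to treat.\<close>
proof (rule dense_ge)
  fix y assume y: "ess_sup M X < y"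
  show "ereal (expectation X) \<le> y"
  proof (cases y)
    case (real t)
    then have "AE \<omega> in M. X \<omega> \<le> t" using y real ess_sup_le_iff[OF assms, of t] less_imp_le by blast
    then have "expectation X \<le> t"
      using integral_mono_AE[OF Lp_integrable[OF assms], of "\<lambda>_. t"] by (simp add: prob_space)
    then show ?thesis using real by simp
  qed (use y in auto)
qed

text \<open>A real essential supremum satisfies the constraint, at \<open>\<infinity>\<close> both
  sides are infinite, and \<open>- \<infinity>\<close> is excluded by the finite mean.\<close>

lemma evar_objective_1_ess_sup:
  assumes "X \<in> Lp M p"
  shows "evar_objective M p 1 X (ess_sup M X) = ess_sup M X"
  using ess_sup_ge_expectation[OF assms] ess_sup_le_iff[OF assms] excess_norm_eq_0_iff[OF assms]
  by (cases "ess_sup M X") (auto simp: evar_objective_1 simp del: evar_objective_ereal)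

section \<open>\<open>EVaR\<close> as the minimum of the objective\<close>

lemma EVaR_le_objective_real:
  assumes X: "X \<in> Lp M p" and \<alpha>: "0 \<le> \<alpha>" "\<alpha> < 1"
  shows "EVaR M p \<alpha> X \<le> ereal (objective (coeff \<alpha>) X t)"
proof -
  have "(\<integral>\<omega>. Z \<omega> * X \<omega> \<partial>M) \<le> objective (coeff \<alpha>) X t"
    if "Z \<in> dual_ball M p (coeff \<alpha>)" "expectation Z = 1" for Z
    using objective_ge_dual[OF X that(1), of t] that(2) coeff_ge_1[OF \<alpha>] by simp
  then show ?thesis
    unfolding EVaR_eq_Sup_dual[OF assms] coeff_def[symmetric] by (auto intro!: Sup_least)
qed

lemma EVaR_ge_dual:
  assumes "X \<in> Lp M p" "0 \<le> \<alpha>" "\<alpha> < 1"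
    and "Z \<in> dual_ball M p (coeff \<alpha>)" "expectation Z = 1"
  shows "ereal (\<integral>\<omega>. Z \<omega> * X \<omega> \<partial>M) \<le> EVaR M p \<alpha> X"
  unfolding EVaR_eq_Sup_dual[OF assms(1-3)] coeff_def[symmetric]
  using assms(4,5) by (intro Sup_upper) auto

lemma EVaR_ge_expectation:
  assumes "X \<in> Lp M p" "0 \<le> \<alpha>" "\<alpha> < 1"
  shows "ereal (expectation X) \<le> EVaR M p \<alpha> X"
  using EVaR_ge_dual[OF assms dual_ball_const[of 1]] coeff_ge_1[OF assms(2,3)]
  by (simp add: prob_space)

text \<open>The upper bound by the objective holds for every real \<open>t\<close> and survives the
  limit at \<open>- \<infinity>\<close>, where the objective tends to the mean.\<close>

lemma EVaR_0:
  assumes "X \<in> Lp M p"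
  shows "EVaR M p 0 X = ereal (expectation X)"
proof (rule antisym[OF _ EVaR_ge_expectation[OF assms]])
  have "((\<lambda>t. ereal (objective 1 X t)) \<longlongrightarrow> ereal (expectation X)) at_bot"
    using objective_1_at_bot[OF assms] by simp
  then show "EVaR M p 0 X \<le> ereal (expectation X)"
    by (rule tendsto_lowerbound)
       (use EVaR_le_objective_real[OF assms, of 0] in \<open>auto simp: eventually_at_bot_linorder\<close>)
qed auto

lemma EVaR_real:
  assumes "X \<in> Lp M p" "0 \<le> \<alpha>" "\<alpha> < 1"
  shows "\<exists>v. EVaR M p \<alpha> X = ereal v"
  using EVaR_ge_expectation[OF assms] EVaR_le_objective_real[OF assms, of 0]
  by (cases "EVaR M p \<alpha> X") auto

lemma EVaR_attained_real:
  assumes "X \<in> Lp M p" "0 < \<alpha>" "\<alpha> < 1"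
  shows "\<exists>t. EVaR M p \<alpha> X = ereal (objective (coeff \<alpha>) X t)"
proof -
  obtain v where v: "EVaR M p \<alpha> X = ereal v" using EVaR_real assms by force
  have "\<exists>t. objective (coeff \<alpha>) X t \<le> v"
  proof (rule objective_attains[OF assms(1) coeff_gt_1[OF assms(2,3)]])
    fix Z assume "Z \<in> dual_ball M p (coeff \<alpha>)" "expectation Z = 1"
    then show "(\<integral>\<omega>. Z \<omega> * X \<omega> \<partial>M) \<le> v"
      using EVaR_ge_dual[of X \<alpha> Z] assms v by simp
  qed
  then obtain t where "objective (coeff \<alpha>) X t \<le> v" ..
  then show ?thesis
    using EVaR_le_objective_real[of X \<alpha> t] assms v by (intro exI[of _ t]) simp
qed

text \<open>The witness changes with the level: \<open>- \<infinity>\<close> at 0, a real number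
  strictly between, the essential supremum at 1.\<close>

lemma EVaR_attained:
  assumes "X \<in> Lp M p" "\<alpha> \<in> {0..1}"
  shows "\<exists>t. evar_objective M p \<alpha> X t = EVaR M p \<alpha> X"
proof -
  consider "\<alpha> = 0" | "0 < \<alpha>" "\<alpha> < 1" | "\<alpha> = 1" using assms(2) by force
  then show ?thesis
  proof cases
    case 1
    then show ?thesis
      using evar_objective_MInf[OF assms] EVaR_0[OF assms(1)] by auto
  next
    case 2
    then obtain t where "EVaR M p \<alpha> X = ereal (objective (coeff \<alpha>) X t)"
      using EVaR_attained_real assms(1) by blast
    then show ?thesis using 2 by (intro exI[of _ "ereal t"]) (simp add: evar_objective_lt_1 del: evar_objective_ereal)
  next
    case 3
    then show ?thesis
      using evar_objective_1_ess_sup[OF assms(1)] by (auto simp: EVaR_def)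
  qed
qed

lemma EVaR_le_evar_objective:
  assumes "X \<in> Lp M p" "\<alpha> \<in> {0..1}"
  shows "EVaR M p \<alpha> X \<le> evar_objective M p \<alpha> X t"
proof (cases t)
  case (real r)
  show ?thesis
  proof (cases "\<alpha> = 1")
    case True
    then show ?thesis
      using ess_sup_le_iff[OF assms(1), of r] excess_norm_eq_0_iff[OF assms(1), of r]
      by (auto simp: real EVaR_def evar_objective_1 simp del: evar_objective_ereal)
  next
    case False
    then show ?thesis
      using EVaR_le_objective_real[OF assms(1), of \<alpha> r] assms(2)
      by (simp add: real evar_objective_lt_1 del: evar_objective_ereal)
  qed
next
  case MInf
  then show ?thesis using assms EVaR_0 by (simp add: evar_objective_MInf)
qed (use assms in simp)

text \<open>A minimiser at the higher level competes at the lower one. This treats level 1, where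
  \<open>EVaR\<close> has a separate definition, like the others.\<close>

lemma EVaR_mono:
  assumes "X \<in> Lp M p" "0 \<le> \<alpha>" "\<alpha> \<le> \<beta>" "\<beta> \<le> 1"
  shows "EVaR M p \<alpha> X \<le> EVaR M p \<beta> X"
proof -
  obtain t where "evar_objective M p \<beta> X t = EVaR M p \<beta> X"
    using EVaR_attained[of X \<beta>] assms by auto
  then show ?thesis
    using EVaR_le_evar_objective[of X \<alpha> t] evar_objective_mono[OF assms, of t] assms by force
qed

text \<open>At level 0 monotonicity makes the set a ray starting at \<open>- \<infinity>\<close>; at
  positive levels convexity and growth at both ends make it a compact real interval.\<close>

lemma evar_objective_minimizers:
  assumes X: "X \<in> Lp M p" and \<alpha>: "0 \<le> \<alpha>" "\<alpha> < 1"
  shows "\<exists>a b. a \<le> b \<and> {t. evar_objective M p \<alpha> X t = EVaR M p \<alpha> X} = {a..b}"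
proof -
  obtain v where v: "EVaR M p \<alpha> X = ereal v" using EVaR_real assms by blast
  \<comment> \<open>The real minimisers, written as a sublevel set so that closedness and convexity
    come from the objective.\<close>
  define R where "R = {t. objective (coeff \<alpha>) X t \<le> v}"
  have c: "coeff \<alpha> > 0" using coeff_ge_1[OF \<alpha>] by simp
  have in_R: "objective (coeff \<alpha>) X t = v \<longleftrightarrow> t \<in> R" for t
    using EVaR_le_objective_real[OF assms, of t] by (auto simp: v R_def)
  have R_le: "t \<le> v" if "t \<in> R" for t
    using that objective_ge[of "coeff \<alpha>" t X] c by (auto simp: R_def)
  have "closed R"
    unfolding R_def using objective_continuous_on[OF X c]
    by (intro closed_Collect_le continuous_on_const) auto
  define S where "S = {t. evar_objective M p \<alpha> X t = EVaR M p \<alpha> X}"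
  have S_real: "ereal t \<in> S \<longleftrightarrow> t \<in> R" for t
    using \<alpha> in_R by (simp add: S_def v evar_objective_lt_1 del: evar_objective_ereal)
  have S_PInf: "\<infinity> \<notin> S" using \<alpha> by (simp add: S_def v)
  have "\<exists>a b. a \<le> b \<and> S = {a..b}"
  proof (cases "\<alpha> = 0")
    case True
    have S_MInf: "- \<infinity> \<in> S"
      using True X by (simp add: S_def evar_objective_MInf EVaR_0)
    show ?thesis
    proof (cases "R = {}")
      case True
      have "t \<in> S \<longleftrightarrow> t \<in> {- \<infinity>..- \<infinity>}" for t
        using S_MInf S_PInf S_real True by (cases t) auto
      then have "S = {- \<infinity>..- \<infinity>}" by blast
      then show ?thesis by blast
    next
      case False
      have bdd: "bdd_above R" using R_le by (rule bdd_aboveI)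
      have "Sup R \<in> R" by (rule closed_contains_Sup[OF False bdd \<open>closed R\<close>])
      moreover have "t \<in> R" if "t \<le> s" "s \<in> R" for t s
        using objective_1_mono[OF X that(1)] that(2) True by (simp add: R_def)
      ultimately have "t \<in> R \<longleftrightarrow> t \<le> Sup R" for t
        using cSup_upper[OF _ bdd] by blast
      then have "t \<in> S \<longleftrightarrow> t \<in> {- \<infinity>..ereal (Sup R)}" for t
        using S_MInf S_PInf S_real by (cases t) auto
      then have "S = {- \<infinity>..ereal (Sup R)}" by blast
      then show ?thesis by (intro exI[of _ "- \<infinity>"] exI[of _ "ereal (Sup R)"]) simp
    qed
  next
    case False
    with \<alpha> have pos: "\<alpha> > 0" by simp
    note c1 = coeff_gt_1[OF pos \<alpha>(2)]
    have S_MInf: "- \<infinity> \<notin> S"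
      using False X \<alpha> by (simp add: S_def v evar_objective_MInf)
    obtain t0 where t0: "t0 \<in> R"
      using EVaR_attained_real[OF X pos \<alpha>(2)] v in_R by auto
    have "\<forall>\<^sub>F t in at_bot. v < objective (coeff \<alpha>) X t"
      using objective_at_bot[OF X c1] by (simp add: filterlim_at_top_dense)
    then obtain m where m: "\<And>t. t \<le> m \<Longrightarrow> v < objective (coeff \<alpha>) X t"
      by (auto simp: eventually_at_bot_linorder)
    \<comment> \<open>Bounded below by the divergence at \<open>- \<infinity>\<close>, above because
      the objective dominates \<open>t\<close>.\<close>
    have "R \<subseteq> {m..v}"
    proof
      fix t assume t: "t \<in> R"
      then have "\<not> t \<le> m" using m[of t] by (auto simp: R_def)
      then show "t \<in> {m..v}" using R_le[OF t] by simp
    qed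
    then have "bounded R" by (rule bounded_subset[rotated]) simp
    with \<open>closed R\<close> have "compact R" by (simp add: compact_eq_bounded_closed)
    moreover have "convex R"
      unfolding convex_def
    proof (intro ballI allI impI)
      fix x y u w :: real
      assume xy: "x \<in> R" "y \<in> R" and uw: "0 \<le> u" "0 \<le> w" "u + w = 1"
      have "objective (coeff \<alpha>) X (u *\<^sub>R x + w *\<^sub>R y)
          \<le> u * objective (coeff \<alpha>) X x + w * objective (coeff \<alpha>) X y"
        using objective_convex_on[OF X c] uw unfolding convex_on_def by blast
      also have "\<dots> \<le> v"
        using xy uw by (intro convex_bound_le) (auto simp: R_def)
      finally show "u *\<^sub>R x + w *\<^sub>R y \<in> R" by (simp add: R_def)
    qed
    then have "connected R" by (rule convex_connected)
    ultimately obtain a b where R: "R = {a..b}"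
      using connected_compact_interval_1[of R] by auto
    have "t \<in> S \<longleftrightarrow> t \<in> {ereal a..ereal b}" for t
      using S_MInf S_PInf S_real R by (cases t) auto
    then have "S = {ereal a..ereal b}" by blast
    then show ?thesis using t0 R by (intro exI[of _ "ereal a"] exI[of _ "ereal b"]) simp
  qed
  then show ?thesis by (simp add: S_def)
qed

lemma VaR_interval:
  assumes X: "X \<in> Lp M p" and \<alpha>: "0 \<le> \<alpha>" "\<alpha> < 1"
  shows "VaR M p \<alpha> X \<le> VaR_plus M p \<alpha> X"
    and "t \<in> {VaR M p \<alpha> X..VaR_plus M p \<alpha> X} \<Longrightarrow> evar_objective M p \<alpha> X t = EVaR M p \<alpha> X"
proof -
  obtain a b where ab: "a \<le> b" "{t. evar_objective M p \<alpha> X t = EVaR M p \<alpha> X} = {a..b}"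
    using evar_objective_minimizers[OF assms] by blast
  have "a \<in> {a..b}" using ab(1) by simp
  then have attained: "evar_objective M p \<alpha> X a = EVaR M p \<alpha> X"
    unfolding ab(2)[symmetric] by blast
  have lower: "EVaR M p \<alpha> X \<le> evar_objective M p \<alpha> X s" for s
    using \<alpha> by (intro EVaR_le_evar_objective[OF X]) auto
  \<comment> \<open>\<open>is_arg_min\<close> only says that no value is strictly smaller;
    attainment at \<open>a\<close> identifies the minimal value with \<open>EVaR\<close>.\<close>
  have "is_arg_min (evar_objective M p \<alpha> X) (\<lambda>_. True) t
          \<longleftrightarrow> evar_objective M p \<alpha> X t = EVaR M p \<alpha> X" for t
  proof
    assume "is_arg_min (evar_objective M p \<alpha> X) (\<lambda>_. True) t"
    then have "\<not> evar_objective M p \<alpha> X a < evar_objective M p \<alpha> X t"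
      unfolding is_arg_min_def by blast
    then show "evar_objective M p \<alpha> X t = EVaR M p \<alpha> X"
      using lower[of t] attained by simp
  next
    assume "evar_objective M p \<alpha> X t = EVaR M p \<alpha> X"
    then show "is_arg_min (evar_objective M p \<alpha> X) (\<lambda>_. True) t"
      using lower unfolding is_arg_min_def by (metis leD)
  qed
  then have "{t. is_arg_min (evar_objective M p \<alpha> X) (\<lambda>_. True) t} = {a..b}"
    unfolding ab(2)[symmetric] by blast
  then have "VaR M p \<alpha> X = Inf {a..b}" "VaR_plus M p \<alpha> X = Sup {a..b}"
    using \<alpha> unfolding VaR_def VaR_plus_def by auto
  then have eq: "VaR M p \<alpha> X = a" "VaR_plus M p \<alpha> X = b" using ab(1) by simp_all
  then show "VaR M p \<alpha> X \<le> VaR_plus M p \<alpha> X" using ab(1) by simp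
  show "evar_objective M p \<alpha> X t = EVaR M p \<alpha> X" if "t \<in> {VaR M p \<alpha> X..VaR_plus M p \<alpha> X}"
    using that ab(2) unfolding eq by blast
qed

end

section \<open>Convexity of \<open>T_Lambda\<close>\<close>

lemma ereal_convex_combination_le_max:
  fixes u v :: ereal
  assumes "0 < l" "l < 1"
  shows "ereal l * u + ereal (1 - l) * v \<le> max u v"
proof -
  have "ereal l * u + ereal (1 - l) * v \<le> ereal l * max u v + ereal (1 - l) * max u v"
    using assms by (intro add_mono ereal_mult_left_mono) auto
  also have "\<dots> = max u v"
    using assms by (cases "max u v") (auto simp: algebra_simps)
  finally show ?thesis .
qed

lemma ext_convex_on_imp_quasiconvex_on:
  assumes "ext_convex_on S f"
  shows "ext_quasiconvex_on S f"
  using assms unfolding ext_convex_on_def ext_quasiconvex_on_def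
  by (meson ereal_convex_combination_le_max order_trans)

lemma max_ereal_convex:
  fixes u v w :: ereal
  assumes "0 < l" "l < 1"
    and "w \<le> ereal l * u + ereal (1 - l) * v"
    and "z \<le> ereal l * x + ereal (1 - l) * y"
  shows "max w z \<le> ereal l * max u x + ereal (1 - l) * max v y"
proof (rule max.boundedI)
  have "ereal l * u + ereal (1 - l) * v \<le> ereal l * max u x + ereal (1 - l) * max v y"
    using assms(1,2) by (intro add_mono ereal_mult_left_mono) auto
  with assms(3) show "w \<le> ereal l * max u x + ereal (1 - l) * max v y" by simp
  have "ereal l * x + ereal (1 - l) * y \<le> ereal l * max u x + ereal (1 - l) * max v y"
    using assms(1,2) by (intro add_mono ereal_mult_left_mono) auto
  with assms(4) show "z \<le> ereal l * max u x + ereal (1 - l) * max v y" by simp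
qed

context Lp_prob_space
begin

lemma comb_fun_eq: "comb l X Y = (\<lambda>\<omega>. l * X \<omega> + (1 - l) * Y \<omega>)" for X Y :: "'a \<Rightarrow> real"
  by (simp add: comb_fun_def comb_real_def)

lemma comb_self: "comb l X X = X" for X :: "'a \<Rightarrow> real"
  by (simp add: comb_fun_eq algebra_simps)

lemma expectation_comb:
  assumes "X \<in> Lp M p" "Y \<in> Lp M p"
  shows "expectation (comb l X Y) = l * expectation X + (1 - l) * expectation Y"
  using Lp_integrable[OF assms(1)] Lp_integrable[OF assms(2)] by (simp add: comb_fun_eq)

text \<open>Joint convexity in the coefficient form covers real points. If one point is
  \<open>\<infinity>\<close>, the right side is infinite; if one is \<open>- \<infinity>\<close>, so
  is the combination, and then either the level is 0 and linearity of the mean suffices or the right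
  side is infinite.\<close>

lemma evar_objective_convex:
  assumes X: "X \<in> Lp M p" and Y: "Y \<in> Lp M p" and \<alpha>: "\<alpha> \<in> {0..1}"
    and ok: "comb_ok s t" and l: "0 < l" "l < 1"
  shows "evar_objective M p \<alpha> (comb l X Y) (comb l s t)
           \<le> ereal l * evar_objective M p \<alpha> X s + ereal (1 - l) * evar_objective M p \<alpha> Y t"
    (is "_ \<le> ?R")
proof -
  have XY: "comb l X Y \<in> Lp M p" unfolding comb_fun_eq by (rule Lp_comb[OF X Y])
  consider (inf) "s = \<infinity> \<or> t = \<infinity>"
    | (minf) "s \<noteq> \<infinity>" "t \<noteq> \<infinity>" "s = - \<infinity> \<or> t = - \<infinity>"
    | (real) r q where "s = ereal r" "t = ereal q"
    by (cases s; cases t) auto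
  then show ?thesis
  proof cases
    case inf
    then have "?R = \<infinity>" using \<alpha> l by auto
    then show ?thesis by (simp only: ereal_less_eq)
  next
    case minf
    have c: "comb l s t = - \<infinity>"
      using minf l by (cases s; cases t) (auto simp: comb_ereal_def)
    show ?thesis
    proof (cases "\<alpha> = 0")
      case True
      have "evar_objective M p \<alpha> (comb l X Y) (comb l s t)
          = ereal l * ereal (expectation X) + ereal (1 - l) * ereal (expectation Y)"
        using XY True by (simp add: c evar_objective_MInf expectation_comb[OF X Y])
      also have "\<dots> \<le> ?R"
        using l X Y \<alpha> by (intro add_mono ereal_mult_left_mono evar_objective_ge_expectation) auto
      finally show ?thesis .
    next
      case False
      then have "?R = \<infinity>" using minf X Y \<alpha> l by (auto simp: evar_objective_MInf)
      then show ?thesis by (simp only: ereal_less_eq)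
    qed
  next
    case real
    have c: "comb l s t = ereal (l * r + (1 - l) * q)"
      by (simp add: real comb_ereal_def)
    show ?thesis
    proof (cases "\<alpha> = 1")
      case True
      show ?thesis
      proof (cases "excess_norm M p X r = 0 \<and> excess_norm M p Y q = 0")
        case zero: True
        then have "excess_norm M p (comb l X Y) (l * r + (1 - l) * q) = 0"
          using excess_norm_convex[OF X Y, of l r q] l excess_norm_nonneg[of "comb l X Y"]
          by (simp add: comb_fun_eq order_antisym)
        then show ?thesis
          unfolding c unfolding real True evar_objective_1 using zero by simp
      next
        case False
        then have "?R = \<infinity>"
          unfolding real True evar_objective_1 using l by auto
        then show ?thesis by (simp only: ereal_less_eq)
      qed
    next
      case False
      then have "coeff \<alpha> > 0" using coeff_ge_1[of \<alpha>] \<alpha> by auto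
      from objective_convex[OF X Y this, of l r q]
      show ?thesis
        unfolding c unfolding real evar_objective_lt_1[OF False] using l
        by (simp add: comb_fun_eq)
    qed
  qed
qed

text \<open>Equal values of \<open>\<Lambda>\<close> at the three points reduce everything to one
  level. This serves both a fixed \<open>x\<close> and a constant \<open>\<Lambda>\<close>.\<close>

lemma T_Lambda_convex:
  assumes "\<Lambda> z = \<Lambda> x" "\<Lambda> y = \<Lambda> x" "\<Lambda> x \<in> {0..1}" "z \<le> l * x + (1 - l) * y"
    and "X \<in> Lp M p" "Y \<in> Lp M p" "comb_ok s t" "0 < l" "l < 1"
  shows "T_Lambda M p \<Lambda> (comb l s t) z (comb l X Y)
           \<le> ereal l * T_Lambda M p \<Lambda> s x X + ereal (1 - l) * T_Lambda M p \<Lambda> t y Y"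
  unfolding T_Lambda_def assms(1,2)
  using assms by (intro max_ereal_convex evar_objective_convex) auto

text \<open>Constants \<open>X = m\<close> with large \<open>m\<close> suffice: along \<open>(m, y)\<close> and \<open>(m - 1, z)\<close> with \<open>y\<close> far to
  the left of \<open>x < z\<close>, quasi-convexity bounds \<open>coeff (\<Lambda> x) - 1\<close> by \<open>coeff (\<Lambda> z) - 1\<close> up to a factor
  arbitrarily close to 1.\<close>

lemma quasiconvex_imp_Lambda_le:
  assumes qc: "\<And>X. X \<in> Lp M p \<Longrightarrow> ext_quasiconvex_on UNIV (\<lambda>(t, x). T_Lambda M p \<Lambda> t x X)"
    and \<Lambda>: "\<And>x. \<Lambda> x \<in> {0..1}" and xz: "x < z"
  shows "\<Lambda> x \<le> \<Lambda> z"
proof (rule ccontr)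
  assume "\<not> \<Lambda> x \<le> \<Lambda> z"
  then have less: "\<Lambda> z < \<Lambda> x" by simp
  then have z1: "\<Lambda> z \<noteq> 1" using \<Lambda>[of x] by auto
  define k where "k = coeff (\<Lambda> z)"
  have k: "k \<ge> 1" unfolding k_def using \<Lambda>[of z] z1 by (intro coeff_ge_1) auto
  define N where "N m t = excess_norm M p (\<lambda>_. m) t" for m t
  have N: "N m t = max (m - t) 0" for m t
    using p_ge_1 by (simp add: N_def excess_norm_def Lp_norm_def prob_space powr_powr)
  have bound: "ereal (- (1 - l)) + level_coeff p (\<Lambda> x) * ereal (1 - l) \<le> ereal (k - 1)"
    if l: "0 < l" "l < 1" for l
  proof -
    \<comment> \<open>Solves \<open>x = l * y + (1 - l) * z\<close>; a small \<open>l\<close> pushes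
      \<open>y\<close> far to the left.\<close>
    define y where "y = (x - (1 - l) * z) / l"
    \<comment> \<open>Large enough that the second entry of the maximum is inactive at both
      endpoints.\<close>
    define m where "m = \<bar>y\<bar> + \<bar>z\<bar> + 1"
    have x: "x = l * y + (1 - l) * z" using l by (simp add: y_def)
    have t: "comb l (ereal m) (ereal (m - 1)) = ereal (m - (1 - l))"
      by (simp add: comb_ereal_def algebra_simps)
    have "T_Lambda M p \<Lambda> (ereal (m - (1 - l))) x (\<lambda>_. m)
        \<le> max (T_Lambda M p \<Lambda> (ereal m) y (\<lambda>_. m)) (T_Lambda M p \<Lambda> (ereal (m - 1)) z (\<lambda>_. m))"
      using qc[OF Lp_const[of m], unfolded ext_quasiconvex_on_def, rule_format,
          of "(ereal m, y)" "(ereal (m - 1), z)" l] l t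
      by (simp add: comb_prod_def comb_ok_prod_def comb_ok_ereal_def comb_ok_real_def
          comb_real_def x)
    \<comment> \<open>At \<open>t = m\<close> the penalty vanishes, so the unknown and possibly
      infinite coefficient at \<open>y\<close> drops out.\<close>
    also have "T_Lambda M p \<Lambda> (ereal m) y (\<lambda>_. m) = ereal m"
      by (simp add: T_Lambda_def N_def[symmetric] N m_def zero_ereal_def[symmetric] max_def)
    also have "T_Lambda M p \<Lambda> (ereal (m - 1)) z (\<lambda>_. m) = ereal (m + (k - 1))"
      using k z1 by (simp add: T_Lambda_def N_def[symmetric] N m_def level_coeff_eq k_def[symmetric])
    also have "max (ereal m) (ereal (m + (k - 1))) = ereal (m + (k - 1))"
      using k by simp
    finally have "ereal (m - (1 - l)) + level_coeff p (\<Lambda> x) * ereal (1 - l) \<le> ereal (m + (k - 1))"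
      using l by (simp add: T_Lambda_def N_def[symmetric] N)
    then show ?thesis
      using l by (cases "level_coeff p (\<Lambda> x)") auto
  qed
  show False
  proof (cases "\<Lambda> x = 1")
    case True
    then show False using bound[of "1/2"] by (simp add: level_coeff_def)
  next
    case False
    define K where "K = coeff (\<Lambda> x)"
    have K: "K > k"
      unfolding K_def k_def using less \<Lambda>[of x] False by (intro coeff_strict_mono) auto
    have le: "(1 - l) * (K - 1) \<le> k - 1" if "0 < l" "l < 1" for l
      using bound[OF that] False by (simp add: level_coeff_eq K_def[symmetric] algebra_simps)
    \<comment> \<open>With this weight \<open>(1 - l) * (K - 1)\<close> is the midpoint of
      \<open>k - 1\<close> and \<open>K - 1\<close>, which exceeds \<open>k - 1\<close>.\<close>
    define l where "l = (K - k) / (2 * (K - 1))"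
    have "0 < l" "l < 1" "l * (K - 1) = (K - k) / 2"
      using K k by (auto simp: l_def divide_simps)
    with le[of l] K show False by (simp add: algebra_simps)
  qed
qed

text \<open>For real \<open>t\<close> the objective is affine in the coefficient with slope a norm,
  hence inherits its convexity. Conversely, a suitable constant \<open>X\<close> makes this slope 1
  and the other entry of the maximum inactive.\<close>

lemma T_Lambda_convex_in_x_iff:
  assumes \<Lambda>: "\<And>x. \<Lambda> x \<in> {0..1}"
  shows "(\<forall>t. \<forall>X\<in>Lp M p. ext_convex_on UNIV (\<lambda>x. T_Lambda M p \<Lambda> t x X))
           \<longleftrightarrow> ext_convex_on UNIV (\<lambda>x. level_coeff p (\<Lambda> x))" (is "?L \<longleftrightarrow> ?R")
proof
  assume ?R
  show ?L
  proof (intro allI ballI)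
    fix t X assume X: "X \<in> Lp M p"
    show "ext_convex_on UNIV (\<lambda>x. T_Lambda M p \<Lambda> t x X)"
      unfolding ext_convex_on_def
    proof (intro ballI allI impI)
      fix x y l :: real assume l: "0 < l \<and> l < 1"
      define z where "z = comb l x y"
      have k: "level_coeff p (\<Lambda> z)
          \<le> ereal l * level_coeff p (\<Lambda> x) + ereal (1 - l) * level_coeff p (\<Lambda> y)"
        using \<open>?R\<close> l by (auto simp: ext_convex_on_def z_def comb_ok_real_def)
      have k1: "level_coeff p (\<Lambda> x) \<ge> 1" for x
        using coeff_ge_1[of "\<Lambda> x"] \<Lambda>[of x] by (cases "\<Lambda> x = 1") (auto simp: level_coeff_eq, simp add: level_coeff_def)
      have "evar_objective M p (\<Lambda> z) X t \<le> ereal l * evar_objective M p (\<Lambda> x) X t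
              + ereal (1 - l) * evar_objective M p (\<Lambda> y) X t"
      proof (cases t)
        case (real r)
        define N where "N = excess_norm M p X r"
        have "N \<ge> 0" unfolding N_def by (rule excess_norm_nonneg)
        then have "ereal r + level_coeff p (\<Lambda> z) * ereal N
          \<le> ereal r + (ereal l * level_coeff p (\<Lambda> x) + ereal (1 - l) * level_coeff p (\<Lambda> y)) * ereal N"
          using k by (intro add_left_mono ereal_mult_right_mono) auto
        also have "\<dots> = ereal l * (ereal r + level_coeff p (\<Lambda> x) * ereal N)
              + ereal (1 - l) * (ereal r + level_coeff p (\<Lambda> y) * ereal N)"
          using k1[of x] k1[of y] l \<open>N \<ge> 0\<close>
          by (cases "level_coeff p (\<Lambda> x)"; cases "level_coeff p (\<Lambda> y)"; cases "N = 0")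
             (auto simp: algebra_simps)
        finally show ?thesis by (simp add: real N_def)
      next
        case MInf
        show ?thesis
        proof (cases "\<Lambda> x = 0 \<and> \<Lambda> y = 0")
          case True
          \<comment> \<open>At \<open>t = - \<infinity>\<close> the objective jumps to infinity off
            level 0, so level 0 at both ends must force level 0 in between.\<close>
          then have "level_coeff p (\<Lambda> z) \<le> 1" using k by (simp add: level_coeff_eq one_ereal_def)
          then have "\<Lambda> z = 0"
            using coeff_gt_1[of "\<Lambda> z"] \<Lambda>[of z]
            by (cases "\<Lambda> z = 1") (force simp: level_coeff_def, force simp: level_coeff_eq)
          then show ?thesis using True X MInf l
            by (simp add: evar_objective_MInf algebra_simps)
        next
          case False
          then have "ereal l * evar_objective M p (\<Lambda> x) X t
              + ereal (1 - l) * evar_objective M p (\<Lambda> y) X t = \<infinity>"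
            using MInf l X \<Lambda> by (auto simp: evar_objective_MInf)
          then show ?thesis by (simp only: ereal_less_eq)
        qed
      qed (use l \<Lambda> in simp)
      then show "T_Lambda M p \<Lambda> t (comb l x y) X
          \<le> ereal l * T_Lambda M p \<Lambda> t x X + ereal (1 - l) * T_Lambda M p \<Lambda> t y X"
        unfolding T_Lambda_def z_def[symmetric]
        by (intro max_ereal_convex) (use l in \<open>auto simp: z_def comb_real_def\<close>)
    qed
  qed
next
  assume L: ?L
  show ?R
    unfolding ext_convex_on_def
  proof (intro ballI allI impI)
    fix x y l :: real assume l: "0 < l \<and> l < 1"
    define z where "z = comb l x y"
    \<comment> \<open>At least as large as all three points, so that \<open>t\<close> plus the
      coefficient wins the maximum; \<open>X = t + 1\<close> then has excess norm 1.\<close>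
    define t where "t = \<bar>x\<bar> + \<bar>y\<bar> + \<bar>z\<bar>"
    have le: "x \<le> t" "y \<le> t" "z \<le> t" by (auto simp: t_def)
    define X where "X = (\<lambda>_::'a. t + 1)"
    have X: "X \<in> Lp M p" unfolding X_def by (rule Lp_const)
    have N: "excess_norm M p X t = 1"
      by (simp add: X_def excess_norm_def Lp_norm_def prob_space)
    have T: "T_Lambda M p \<Lambda> (ereal t) w X = ereal t + level_coeff p (\<Lambda> w)" if "w \<le> t" for w
    proof -
      have "level_coeff p (\<Lambda> w) \<ge> 0" by (simp add: level_coeff_def)
      with that have "ereal w + 0 \<le> ereal t + level_coeff p (\<Lambda> w)"
        by (intro add_mono) auto
      then show ?thesis by (simp add: T_Lambda_def N one_ereal_def[symmetric] max_def antisym)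
    qed
    have "T_Lambda M p \<Lambda> (ereal t) z X
        \<le> ereal l * T_Lambda M p \<Lambda> (ereal t) x X + ereal (1 - l) * T_Lambda M p \<Lambda> (ereal t) y X"
      using L X l by (auto simp: ext_convex_on_def z_def comb_ok_real_def)
    then have "ereal t + level_coeff p (\<Lambda> z) \<le> ereal l * (ereal t + level_coeff p (\<Lambda> x))
        + ereal (1 - l) * (ereal t + level_coeff p (\<Lambda> y))"
      unfolding T[OF le(1)] T[OF le(2)] T[OF le(3)] .
    then have "level_coeff p (\<Lambda> z)
        \<le> ereal l * level_coeff p (\<Lambda> x) + ereal (1 - l) * level_coeff p (\<Lambda> y)"
      using l by (auto simp: level_coeff_def algebra_simps split: if_splits)
    then show "level_coeff p (\<Lambda> (comb l x y))
        \<le> ereal l * level_coeff p (\<Lambda> x) + ereal (1 - l) * level_coeff p (\<Lambda> y)"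
      by (simp add: z_def)
  qed
qed

section \<open>Right-continuity in the level\<close>

text \<open>Concavity along the segment from \<open>coeff \<alpha>\<close> down to 1, where the
  value is the mean: the minimiser at the intermediate level competes at both ends.\<close>

lemma EVaR_concave:
  assumes X: "X \<in> Lp M p" and \<alpha>: "0 < \<alpha>" "\<alpha> < 1"
    and \<beta>: "0 \<le> \<beta>" "\<beta> < 1" and l: "0 \<le> l" "l \<le> 1" "coeff \<beta> = (1 - l) * coeff \<alpha> + l"
    and v: "EVaR M p \<alpha> X = ereal v"
  shows "ereal ((1 - l) * v + l * expectation X) \<le> EVaR M p \<beta> X"
proof (cases "\<beta> = 0")
  case True
  \<comment> \<open>At level 0 a real minimiser need not exist, but the weight degenerates to
    1.\<close>
  then have "(1 - l) * (coeff \<alpha> - 1) = 0" using l by (simp add: algebra_simps)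
  then have "l = 1" using coeff_gt_1[OF \<alpha>] by simp
  then show ?thesis using True EVaR_0[OF X] by simp
next
  case False
  then obtain t where t: "EVaR M p \<beta> X = ereal (objective (coeff \<beta>) X t)"
    using EVaR_attained_real[OF X, of \<beta>] \<beta> by auto
  have "v \<le> objective (coeff \<alpha>) X t"
    using EVaR_le_objective_real[OF X, of \<alpha> t] \<alpha> v by simp
  moreover have "expectation X \<le> objective 1 X t"
    by (rule objective_ge_expectation[OF X]) simp
  ultimately have "(1 - l) * v + l * expectation X
      \<le> (1 - l) * objective (coeff \<alpha>) X t + l * objective 1 X t"
    using l by (intro add_mono mult_left_mono) auto
  also have "\<dots> = objective (coeff \<beta>) X t"
    by (simp add: objective_def l(3) algebra_simps)
  finally show ?thesis using t by simp
qed

section \<open>Densities concentrated on an event\<close>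

lemma dual_ball_mono:
  assumes "Z \<in> dual_ball M p c" "0 \<le> c" "c \<le> d"
  shows "Z \<in> dual_ball M p d"
proof -
  have "c powr (p / (p - 1)) \<le> d powr (p / (p - 1))"
    using assms(2,3) p_ge_1 by (intro powr_mono2) auto
  moreover have "AE \<omega> in M. Z \<omega> \<le> d" if "p = 1"
    using dual_ball_D(3)[OF assms(1) that] assms(3) by (auto elim!: eventually_mono)
  ultimately show ?thesis using assms(1) by (auto simp: dual_ball_def)
qed

text \<open>The \<open>q\<close>-th moment is \<open>(1 / prob A) powr (q - 1)\<close>, the
  \<open>q\<close>-th power of the radius because \<open>q / p = q - 1\<close>.\<close>

lemma dual_ball_indicator:
  assumes A: "A \<in> events" and pos: "prob A > 0"
  shows "(\<lambda>\<omega>. indicator A \<omega> / prob A) \<in> dual_ball M p ((1 / prob A) powr (1 / p))"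
proof -
  note [measurable] = A
  have "(\<integral>\<omega>. (indicator A \<omega> / prob A) powr q \<partial>M) = (1 / prob A) powr (q - 1)"
    and "integrable M (\<lambda>\<omega>. (indicator A \<omega> / prob A) powr q)" for q
  proof -
    have eq: "(indicator A \<omega> / prob A) powr q = indicator A \<omega> * (1 / prob A) powr q" for \<omega>
      by (auto simp: indicator_def)
    show "integrable M (\<lambda>\<omega>. (indicator A \<omega> / prob A) powr q)"
      unfolding eq using A
      by (intro integrable_mult_left integrable_real_indicator) (auto simp: emeasure_eq_measure)
    show "(\<integral>\<omega>. (indicator A \<omega> / prob A) powr q \<partial>M) = (1 / prob A) powr (q - 1)"
      unfolding eq using pos A by (simp add: powr_diff powr_divide)
  qed
  moreover have "1 / p * (p / (p - 1)) = p / (p - 1) - 1" if "p \<noteq> 1"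
    using that p_ge_1 by (simp add: field_simps)
  ultimately show ?thesis
    using pos A by (auto simp: dual_ball_def powr_powr indicator_def divide_right_mono)
qed

text \<open>The density \<open>1\<^sub>A / P(A)\<close> with \<open>A = {X > y}\<close> is admissible at level \<open>\<beta>\<close>.\<close>

lemma EVaR_ge_threshold:
  assumes X: "X \<in> Lp M p" and \<beta>: "0 \<le> \<beta>" "\<beta> < 1"
    and A: "1 - \<beta> \<le> prob {\<omega> \<in> space M. X \<omega> > y}"
  shows "ereal y \<le> EVaR M p \<beta> X"
proof -
  define A where "A = {\<omega> \<in> space M. X \<omega> > y}"
  note [measurable] = Lp_D(1)[OF X]
  have Aev[measurable]: "A \<in> events" unfolding A_def by measurable
  have pos: "prob A > 0" and le: "1 - \<beta> \<le> prob A"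
    using A \<beta> by (auto simp: A_def)
  define Z where "Z = (\<lambda>\<omega>. indicator A \<omega> / prob A :: real)"
  have "(1 / prob A) powr (1 / p) \<le> coeff \<beta>"
    unfolding coeff_def using le pos \<beta> p_ge_1 by (intro powr_mono2 divide_left_mono) auto
  then have Z: "Z \<in> dual_ball M p (coeff \<beta>)"
    using dual_ball_mono[OF dual_ball_indicator[OF Aev pos, folded Z_def]] by simp
  have E: "expectation Z = 1" using pos by (simp add: Z_def)
  have "y = (\<integral>\<omega>. Z \<omega> * y \<partial>M)" using E by simp
  also have "\<dots> \<le> (\<integral>\<omega>. Z \<omega> * X \<omega> \<partial>M)"
  proof (rule integral_mono[OF _ Holder_integrable[OF X Z]])
    show "integrable M (\<lambda>\<omega>. Z \<omega> * y)" using dual_ball_integrable[OF Z] by simp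
    show "Z \<omega> * y \<le> Z \<omega> * X \<omega>" for \<omega>
      using pos by (auto simp: Z_def A_def indicator_def divide_right_mono)
  qed
  finally show ?thesis
    using EVaR_ge_dual[OF X \<beta> Z E] by (meson ereal_less_eq(3) order_trans)
qed

text \<open>As \<open>x\<close> decreases to \<open>x0\<close> the levels increase to
  \<open>\<Lambda> x0\<close>, so the point is left-continuity of \<open>EVaR\<close> in the level:
  by concavity in the coefficient inside (0, 1), by tail events at level 1.\<close>

lemma EVaR_right_limit:
  assumes X: "X \<in> Lp M p" and \<Lambda>: "\<And>x. \<Lambda> x \<in> {0..1}" and mono: "antimono \<Lambda>"
    and cont: "continuous (at_right x0) \<Lambda>"
    and le: "\<And>x. x > x0 \<Longrightarrow> EVaR M p (\<Lambda> x) X \<le> ereal x0"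
  shows "EVaR M p (\<Lambda> x0) X \<le> ereal x0"
proof (cases "\<Lambda> x0 = 1")
  case True
  have lim: "(\<Lambda> \<longlongrightarrow> 1) (at_right x0)"
    using cont True by (simp add: continuous_within)
  show ?thesis
  proof (rule ccontr)
    assume "\<not> ?thesis"
    then have "ereal x0 < ess_sup M X" using True by (simp add: EVaR_def)
    \<comment> \<open>Levels close to 1 exceed \<open>1 - \<delta>\<close>, with
      \<open>\<delta>\<close> the probability of \<open>X > y\<close>, and there \<open>EVaR\<close>
      is at least \<open>y\<close>, against the bound \<open>x0\<close>.\<close>
    then obtain y where y: "x0 < y" "ereal y < ess_sup M X"
      using ereal_dense2 by (metis ereal_less(2) less_ereal.simps(1))
    note [measurable] = Lp_D(1)[OF X]
    define \<delta> where "\<delta> = prob {\<omega> \<in> space M. X \<omega> > y}"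
    have "emeasure M {\<omega> \<in> space M. ereal (X \<omega>) > ereal y} > 0"
      using y(2) unfolding ess_sup_def by (intro esssup_pos_measure) auto
    then have "\<delta> > 0" by (simp add: \<delta>_def emeasure_eq_measure)
    then have "\<forall>\<^sub>F x in at_right x0. 1 - \<delta> < \<Lambda> x"
      using lim by (intro order_tendstoD(1)) auto
    then have "\<forall>\<^sub>F x in at_right x0. 1 - \<delta> < \<Lambda> x \<and> x0 < x"
      using eventually_at_right_less[of x0] by eventually_elim simp
    then obtain x where x: "1 - \<delta> < \<Lambda> x" "x0 < x"
      using eventually_happens[of _ "at_right x0"] trivial_limit_at_right_real by blast
    have "ereal y \<le> EVaR M p (\<Lambda> x) X"
    proof (cases "\<Lambda> x = 1")
      case True
      then show ?thesis using y by (simp add: EVaR_def less_imp_le)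
    next
      case False
      then show ?thesis
        using x \<Lambda>[of x] by (intro EVaR_ge_threshold[OF X]) (auto simp: \<delta>_def)
    qed
    also have "\<dots> \<le> ereal x0" by (rule le[OF x(2)])
    finally show False using y by simp
  qed
next
  case False
  then have lt1: "\<Lambda> x0 < 1" using \<Lambda>[of x0] by auto
  show ?thesis
  proof (cases "\<Lambda> x0 = 0")
    case True
    \<comment> \<open>A decreasing \<open>\<Lambda>\<close> stays at 0 to the right, so no limit has
      to be taken.\<close>
    have "\<Lambda> (x0 + 1) = 0" using antimonoD[OF mono, of x0 "x0 + 1"] \<Lambda>[of "x0 + 1"] True by auto
    then show ?thesis using le[of "x0 + 1"] True by simp
  next
    case False
    then have pos: "0 < \<Lambda> x0" using \<Lambda>[of x0] by auto
    obtain v where v: "EVaR M p (\<Lambda> x0) X = ereal v" using EVaR_real[OF X, of "\<Lambda> x0"] pos lt1 by auto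
    define c where "c = coeff (\<Lambda> x0)"
    have c: "c > 1" unfolding c_def by (rule coeff_gt_1[OF pos lt1])
    \<comment> \<open>The weight placing \<open>coeff (\<Lambda> x)\<close> on the segment from
      \<open>c\<close> to 1; it tends to 0 as \<open>x\<close> approaches \<open>x0\<close>.\<close>
    define l where "l x = (c - coeff (\<Lambda> x)) / (c - 1)" for x
    have lim: "(\<Lambda> \<longlongrightarrow> \<Lambda> x0) (at_right x0)"
      using cont by (simp add: continuous_within)
    have "((\<lambda>x. coeff (\<Lambda> x)) \<longlongrightarrow> c) (at_right x0)"
      unfolding coeff_def c_def using lt1 by (intro tendsto_intros lim) auto
    then have "((\<lambda>x. (1 - l x) * v + l x * expectation X)
        \<longlongrightarrow> (1 - (c - c) / (c - 1)) * v + (c - c) / (c - 1) * expectation X) (at_right x0)"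
      unfolding l_def using c by (intro tendsto_intros) auto
    moreover have "\<forall>\<^sub>F x in at_right x0. (1 - l x) * v + l x * expectation X \<le> x0"
      using eventually_at_right_less[of x0]
    proof eventually_elim
      case (elim x)
      have L: "0 \<le> \<Lambda> x" "\<Lambda> x \<le> \<Lambda> x0" "\<Lambda> x < 1"
        using \<Lambda>[of x] antimonoD[OF mono, of x0 x] elim lt1 by auto
      have "1 \<le> coeff (\<Lambda> x)" "coeff (\<Lambda> x) \<le> c"
        using coeff_ge_1[OF L(1,3)] coeff_mono[OF L(2) lt1] by (auto simp: c_def)
      then have l: "0 \<le> l x" "l x \<le> 1" using c by (auto simp: l_def)
      have "l x * (c - 1) = c - coeff (\<Lambda> x)" using c by (simp add: l_def)
      then have "coeff (\<Lambda> x) = (1 - l x) * coeff (\<Lambda> x0) + l x"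
        by (simp add: c_def algebra_simps)
      from EVaR_concave[OF X pos lt1 L(1,3) l this v] le[OF elim]
      have "ereal ((1 - l x) * v + l x * expectation X) \<le> ereal x0" by (rule order_trans)
      then show ?case by simp
    qed
    ultimately have "(1 - (c - c) / (c - 1)) * v + (c - c) / (c - 1) * expectation X \<le> x0"
      by (intro tendsto_upperbound) auto
    then show ?thesis using v by simp
  qed
qed

text \<open>Terms with \<open>y \<le> x\<close> lie below the second entry of the maximum; for
  \<open>y > x\<close> the level can only drop, so \<open>EVaR\<close> at \<open>y\<close> lies
  below the objective at \<open>x\<close>.\<close>

lemma EVaR_Lambda_le_T_Lambda:
  assumes X: "X \<in> Lp M p" and \<Lambda>: "\<And>x. \<Lambda> x \<in> {0..1}" and mono: "antimono \<Lambda>"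
  shows "EVaR_Lambda M p \<Lambda> X \<le> T_Lambda M p \<Lambda> t x X"
  unfolding EVaR_Lambda_def
proof (rule SUP_least)
  fix y
  show "min (EVaR M p (\<Lambda> y) X) (ereal y) \<le> T_Lambda M p \<Lambda> t x X"
  proof (cases "y \<le> x")
    case True
    then show ?thesis by (simp add: T_Lambda_def min_le_iff_disj le_max_iff_disj)
  next
    case False
    then have "EVaR M p (\<Lambda> y) X \<le> EVaR M p (\<Lambda> x) X"
      using \<Lambda>[of x] \<Lambda>[of y] antimonoD[OF mono, of x y] by (intro EVaR_mono[OF X]) auto
    also have "\<dots> \<le> evar_objective M p (\<Lambda> x) X t" by (rule EVaR_le_evar_objective[OF X \<Lambda>])
    finally show ?thesis by (simp add: T_Lambda_def min_le_iff_disj le_max_iff_disj)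
  qed
qed

lemma EVaR_Lambda_attained:
  assumes X: "X \<in> Lp M p" and \<Lambda>: "\<And>x. \<Lambda> x \<in> {0..1}" and mono: "antimono \<Lambda>"
    and cont: "\<And>x. continuous (at_right x) \<Lambda>"
    and x0: "EVaR_Lambda M p \<Lambda> X = ereal x0"
  shows "\<Lambda> x0 < 1 \<Longrightarrow> t \<in> {VaR M p (\<Lambda> x0) X..VaR_plus M p (\<Lambda> x0) X}
           \<Longrightarrow> T_Lambda M p \<Lambda> t x0 X = ereal x0"
    and "\<Lambda> x0 = 1 \<Longrightarrow> T_Lambda M p \<Lambda> (VaR_plus M p 1 X) x0 X = ereal x0"
proof -
  \<comment> \<open>The minimum is at most \<open>x0 < x\<close>, so it cannot be attained by
    \<open>x\<close> alone.\<close>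
  have "EVaR M p (\<Lambda> x) X \<le> ereal x0" if "x > x0" for x
  proof -
    have "min (EVaR M p (\<Lambda> x) X) (ereal x) \<le> ereal x0"
      unfolding x0[symmetric] EVaR_Lambda_def by (rule SUP_upper) simp
    then show ?thesis using that by (simp add: min_le_iff_disj)
  qed
  from EVaR_right_limit[OF X \<Lambda> mono cont this]
  have le: "EVaR M p (\<Lambda> x0) X \<le> ereal x0" .
  show "T_Lambda M p \<Lambda> t x0 X = ereal x0"
    if "\<Lambda> x0 < 1" "t \<in> {VaR M p (\<Lambda> x0) X..VaR_plus M p (\<Lambda> x0) X}"
    using VaR_interval(2)[OF X _ that] \<Lambda>[of x0] le by (simp add: T_Lambda_def max_absorb2)
  show "T_Lambda M p \<Lambda> (VaR_plus M p 1 X) x0 X = ereal x0" if "\<Lambda> x0 = 1"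
    using evar_objective_1_ess_sup[OF X] le that
    by (simp add: T_Lambda_def VaR_plus_def EVaR_def max_absorb2)
qed

end

theorem theorem4p2:
  fixes M :: "'a measure" and p :: real and \<Lambda> :: "real \<Rightarrow> real"
  assumes "prob_space M" and "atomless M"
    and "p \<ge> 1"
    and "\<And>x. \<Lambda> x \<in> {0..1}"
    and "antimono \<Lambda>"
    and "\<And>x. continuous (at_right x) \<Lambda>"
    and "\<And>X. X \<in> Lp M p \<Longrightarrow> \<bar>EVaR_Lambda M p \<Lambda> X\<bar> \<noteq> \<infinity>"
  shows
    "(\<forall>X\<in>Lp M p.
        EVaR_Lambda M p \<Lambda> X \<in> range (\<lambda>(t, x). T_Lambda M p \<Lambda> t x X) \<and>
        (\<forall>t x. EVaR_Lambda M p \<Lambda> X \<le> T_Lambda M p \<Lambda> t x X) \<and>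
        (\<exists>x\<^sub>0::real. EVaR_Lambda M p \<Lambda> X = ereal x\<^sub>0 \<and>
           (\<Lambda> x\<^sub>0 < 1 \<longrightarrow>
              VaR M p (\<Lambda> x\<^sub>0) X \<le> VaR_plus M p (\<Lambda> x\<^sub>0) X \<and>
              (\<forall>t\<^sub>0 \<in> {VaR M p (\<Lambda> x\<^sub>0) X .. VaR_plus M p (\<Lambda> x\<^sub>0) X}.
                 T_Lambda M p \<Lambda> t\<^sub>0 x\<^sub>0 X = EVaR_Lambda M p \<Lambda> X)) \<and>
           (\<Lambda> x\<^sub>0 = 1 \<longrightarrow>
              T_Lambda M p \<Lambda> (VaR_plus M p 1 X) x\<^sub>0 X = EVaR_Lambda M p \<Lambda> X)))
     \<and> (\<forall>x. ext_convex_on (UNIV \<times> Lp M p) (\<lambda>(t, X). T_Lambda M p \<Lambda> t x X))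
     \<and> ((\<forall>t. \<forall>X\<in>Lp M p. ext_convex_on UNIV (\<lambda>x. T_Lambda M p \<Lambda> t x X))
          \<longleftrightarrow> ext_convex_on UNIV (\<lambda>x. level_coeff p (\<Lambda> x)))
     \<and> ((\<forall>X\<in>Lp M p. ext_convex_on UNIV (\<lambda>(t, x). T_Lambda M p \<Lambda> t x X))
          \<longleftrightarrow> (\<forall>X\<in>Lp M p. ext_quasiconvex_on UNIV (\<lambda>(t, x). T_Lambda M p \<Lambda> t x X)))
     \<and> ((\<forall>X\<in>Lp M p. ext_quasiconvex_on UNIV (\<lambda>(t, x). T_Lambda M p \<Lambda> t x X))
          \<longleftrightarrow> ext_convex_on (UNIV \<times> UNIV \<times> Lp M p) (\<lambda>(t, x, X). T_Lambda M p \<Lambda> t x X))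
     \<and> (ext_convex_on (UNIV \<times> UNIV \<times> Lp M p) (\<lambda>(t, x, X). T_Lambda M p \<Lambda> t x X)
          \<longleftrightarrow> ext_quasiconvex_on (UNIV \<times> UNIV \<times> Lp M p) (\<lambda>(t, x, X). T_Lambda M p \<Lambda> t x X))
     \<and> (ext_quasiconvex_on (UNIV \<times> UNIV \<times> Lp M p) (\<lambda>(t, x, X). T_Lambda M p \<Lambda> t x X)
          \<longleftrightarrow> \<Lambda> constant_on UNIV)"
    (is "?min \<and> ?i \<and> (?ii \<longleftrightarrow> ?ii') \<and> (?a \<longleftrightarrow> ?b) \<and> (?b \<longleftrightarrow> ?c) \<and> (?c \<longleftrightarrow> ?d) \<and> (?d \<longleftrightarrow> ?e)")
proof -
  interpret Lp_prob_space M p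
    using assms(1,3) by (simp add: Lp_prob_space_def Lp_prob_space_axioms_def)
  note \<Lambda> = assms(4)
  have ?min
  proof
    fix X assume X: "X \<in> Lp M p"
    obtain x\<^sub>0 where x0: "EVaR_Lambda M p \<Lambda> X = ereal x\<^sub>0"
      using assms(7)[OF X] by (cases "EVaR_Lambda M p \<Lambda> X") auto
    note att = EVaR_Lambda_attained[OF X \<Lambda> assms(5,6) x0]
    have VaR_le: "VaR M p (\<Lambda> x\<^sub>0) X \<le> VaR_plus M p (\<Lambda> x\<^sub>0) X" if "\<Lambda> x\<^sub>0 < 1"
      using VaR_interval(1)[OF X _ that] \<Lambda>[of x\<^sub>0] by simp
    have "\<exists>t. T_Lambda M p \<Lambda> t x\<^sub>0 X = ereal x\<^sub>0"
    proof (cases "\<Lambda> x\<^sub>0 < 1")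
      case True
      then show ?thesis using att(1)[OF True, of "VaR M p (\<Lambda> x\<^sub>0) X"] VaR_le by auto
    next
      case False
      then show ?thesis using att(2) \<Lambda>[of x\<^sub>0] by force
    qed
    then obtain t where "T_Lambda M p \<Lambda> t x\<^sub>0 X = ereal x\<^sub>0" ..
    then have "EVaR_Lambda M p \<Lambda> X \<in> range (\<lambda>(t, x). T_Lambda M p \<Lambda> t x X)"
      unfolding x0 by (intro image_eqI[of _ _ "(t, x\<^sub>0)"]) auto
    moreover have "\<forall>t x. EVaR_Lambda M p \<Lambda> X \<le> T_Lambda M p \<Lambda> t x X"
      using EVaR_Lambda_le_T_Lambda[OF X \<Lambda> assms(5)] by blast
    ultimately show "EVaR_Lambda M p \<Lambda> X \<in> range (\<lambda>(t, x). T_Lambda M p \<Lambda> t x X) \<and>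
        (\<forall>t x. EVaR_Lambda M p \<Lambda> X \<le> T_Lambda M p \<Lambda> t x X) \<and>
        (\<exists>x\<^sub>0::real. EVaR_Lambda M p \<Lambda> X = ereal x\<^sub>0 \<and>
           (\<Lambda> x\<^sub>0 < 1 \<longrightarrow>
              VaR M p (\<Lambda> x\<^sub>0) X \<le> VaR_plus M p (\<Lambda> x\<^sub>0) X \<and>
              (\<forall>t\<^sub>0 \<in> {VaR M p (\<Lambda> x\<^sub>0) X .. VaR_plus M p (\<Lambda> x\<^sub>0) X}.
                 T_Lambda M p \<Lambda> t\<^sub>0 x\<^sub>0 X = EVaR_Lambda M p \<Lambda> X)) \<and>
           (\<Lambda> x\<^sub>0 = 1 \<longrightarrow>
              T_Lambda M p \<Lambda> (VaR_plus M p 1 X) x\<^sub>0 X = EVaR_Lambda M p \<Lambda> X))"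
      using x0 VaR_le att by auto
  qed
  moreover have ?i
  proof
    fix x
    show "ext_convex_on (UNIV \<times> Lp M p) (\<lambda>(t, X). T_Lambda M p \<Lambda> t x X)"
      unfolding ext_convex_on_def
    proof (intro ballI allI impI)
      fix u v :: "ereal \<times> ('a \<Rightarrow> real)" and l :: real
      assume uv: "u \<in> UNIV \<times> Lp M p" "v \<in> UNIV \<times> Lp M p" "comb_ok u v" and l: "0 < l \<and> l < 1"
      have "T_Lambda M p \<Lambda> (comb l (fst u) (fst v)) x (comb l (snd u) (snd v))
          \<le> ereal l * T_Lambda M p \<Lambda> (fst u) x (snd u) + ereal (1 - l) * T_Lambda M p \<Lambda> (fst v) x (snd v)"
        by (rule T_Lambda_convex[where \<Lambda> = \<Lambda>, OF refl refl \<Lambda>])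
           (use uv l in \<open>auto simp: comb_ok_prod_def algebra_simps\<close>)
      then show "(\<lambda>(t, X). T_Lambda M p \<Lambda> t x X) (comb l u v)
          \<le> ereal l * (\<lambda>(t, X). T_Lambda M p \<Lambda> t x X) u + ereal (1 - l) * (\<lambda>(t, X). T_Lambda M p \<Lambda> t x X) v"
        by (simp add: comb_prod_def case_prod_unfold)
    qed
  qed
  moreover have "?ii \<longleftrightarrow> ?ii'" by (rule T_Lambda_convex_in_x_iff[OF \<Lambda>])
  \<comment> \<open>The equivalences close through the cycle e, c, d, b, e, with a inserted between
    c and b.\<close>
  moreover have ?c if e: ?e
    unfolding ext_convex_on_def
  proof (intro ballI allI impI)
    obtain k where k: "\<Lambda> x = k" for x using e unfolding constant_on_def by blast
    then have const: "\<Lambda> x = \<Lambda> y" for x y by metis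
    fix u v :: "ereal \<times> real \<times> ('a \<Rightarrow> real)" and l :: real
    assume uv: "u \<in> UNIV \<times> UNIV \<times> Lp M p" "v \<in> UNIV \<times> UNIV \<times> Lp M p" "comb_ok u v"
      and l: "0 < l \<and> l < 1"
    have "T_Lambda M p \<Lambda> (comb l (fst u) (fst v)) (comb l (fst (snd u)) (fst (snd v)))
            (comb l (snd (snd u)) (snd (snd v)))
        \<le> ereal l * T_Lambda M p \<Lambda> (fst u) (fst (snd u)) (snd (snd u))
          + ereal (1 - l) * T_Lambda M p \<Lambda> (fst v) (fst (snd v)) (snd (snd v))"
      by (rule T_Lambda_convex[where \<Lambda> = \<Lambda>, OF const const \<Lambda>])
         (use uv l in \<open>auto simp: comb_ok_prod_def comb_real_def\<close>)
    then show "(\<lambda>(t, x, X). T_Lambda M p \<Lambda> t x X) (comb l u v)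
        \<le> ereal l * (\<lambda>(t, x, X). T_Lambda M p \<Lambda> t x X) u + ereal (1 - l) * (\<lambda>(t, x, X). T_Lambda M p \<Lambda> t x X) v"
      by (simp add: comb_prod_def case_prod_unfold)
  qed
  moreover have "?c \<Longrightarrow> ?d" by (rule ext_convex_on_imp_quasiconvex_on)
  moreover have "?a \<Longrightarrow> ?b" using ext_convex_on_imp_quasiconvex_on by blast
  \<comment> \<open>Joint convexity is restricted to equal \<open>X\<close> in both points; by
    \<open>comb_self\<close> their combination is \<open>X\<close> again.\<close>
  moreover have "?c \<Longrightarrow> ?a"
  proof
    fix X assume c: ?c and X: "X \<in> Lp M p"
    show "ext_convex_on UNIV (\<lambda>(t, x). T_Lambda M p \<Lambda> t x X)"
      unfolding ext_convex_on_def
    proof (intro ballI allI impI)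
      fix u v :: "ereal \<times> real" and l :: real assume "comb_ok u v" "0 < l \<and> l < 1"
      then show "(\<lambda>(t, x). T_Lambda M p \<Lambda> t x X) (comb l u v)
          \<le> ereal l * (\<lambda>(t, x). T_Lambda M p \<Lambda> t x X) u + ereal (1 - l) * (\<lambda>(t, x). T_Lambda M p \<Lambda> t x X) v"
        using c[unfolded ext_convex_on_def, rule_format, of "(fst u, snd u, X)" "(fst v, snd v, X)" l] X
        by (simp add: comb_prod_def comb_ok_prod_def comb_ok_fun_def comb_ok_real_def comb_self
            case_prod_unfold)
    qed
  qed
  moreover have "?d \<Longrightarrow> ?b"
  proof
    fix X assume d: ?d and X: "X \<in> Lp M p"
    show "ext_quasiconvex_on UNIV (\<lambda>(t, x). T_Lambda M p \<Lambda> t x X)"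
      unfolding ext_quasiconvex_on_def
    proof (intro ballI allI impI)
      fix u v :: "ereal \<times> real" and l :: real assume "comb_ok u v" "0 < l \<and> l < 1"
      then show "(\<lambda>(t, x). T_Lambda M p \<Lambda> t x X) (comb l u v)
          \<le> max ((\<lambda>(t, x). T_Lambda M p \<Lambda> t x X) u) ((\<lambda>(t, x). T_Lambda M p \<Lambda> t x X) v)"
        using d[unfolded ext_quasiconvex_on_def, rule_format, of "(fst u, snd u, X)" "(fst v, snd v, X)" l] X
        by (simp add: comb_prod_def comb_ok_prod_def comb_ok_fun_def comb_ok_real_def comb_self
            case_prod_unfold)
    qed
  qed
  moreover have ?e if b: ?b
  proof -
    \<comment> \<open>Quasi-convexity forces \<open>\<Lambda>\<close> to be increasing, and it is
      decreasing by assumption.\<close>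
    have "\<Lambda> x = \<Lambda> z" if "x < z" for x z
    proof (rule antisym)
      show "\<Lambda> x \<le> \<Lambda> z" by (rule quasiconvex_imp_Lambda_le[OF _ \<Lambda> that]) (use b in blast)
      show "\<Lambda> z \<le> \<Lambda> x" by (rule antimonoD[OF assms(5)]) (use that in simp)
    qed
    then have "\<Lambda> x = \<Lambda> 0" for x by (metis linorder_cases)
    then show ?e unfolding constant_on_def by blast
  qed
  ultimately show ?thesis by argo
qed

end
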